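(* Let $L$ be an oriented classical link in $\mathbb{R}^3$, let $X$ be a finite quandle, $A$ an abelian group, and $\phi\colon X^2\to A$ a quandle $2$-cocycle. Let $\sigma^\sharp\phi\colon X^3\to A$ be the $3$-cocycle $\sigma^\sharp\phi(x,y,z)=\phi(y,z)-\phi(x,z)+\phi(x,y)$. Then for each $x\in X$ the shadow cocycle invariant of $L$ associated with $\sigma^\sharp\phi$ equals the quandle cocycle invariant of $L$ associated with $\phi$: $$\Phi^x_{\sigma^\sharp\phi}(L)=\Phi_\phi(L)\in\mathbb{Z}[A].$$
   Context: **Quandle (co)homology.** A quandle is a set $X$ with a binary operation $*$ such that for all $x,y,z\in X$: $x*x=x$; the map $s_x\colon X\to X$, $y\mapsto y*x$, is bijective; $(x*y)*z=(x*z)*(y*z)$. Let $C_n^R(X)$ be the free abelian group on $X^n$ for $n\ge1$ and $0$ for $n\le0$. Put $\partial^0_n=\partial^1_n=0$ for $n\le 1$ and, for $n\ge2$, $$\partial_n^0(x_1,\dots,x_n)=\sum_{i=1}^n(-1)^i(x_1,\dots,x_{i-1},x_{i+1},\dots,x_n),$$ $$\partial_n^1(x_1,\dots,x_n)=\sum_{i=1}^n(-1)^i(x_1*x_i,\dots,x_{i-1}*x_i,x_{i+1},\dots,x_n),$$ $\partial_n=\partial_n^0-\partial_n^1$. Let $C_n^D(X)\subset C_n^R(X)$ be generated by tuples with $x_i=x_{i+1}$ for some $i$ ($0$ for $n\le1$), and $C_n^Q(X)=C_n^R(X)/C_n^D(X)$ with the induced maps. Cochains are $C_Q^n(X;A)=\mathrm{Hom}_{\mathbb{Z}}(C_n^Q(X),A)$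 with the dual coboundary; $Z_Q^n(X;A)$ denotes the $n$-cocycles, viewed as maps $X^n\to A$. Explicitly $\phi\colon X^2\to A$ is a $2$-cocycle iff $\phi(x,x)=0$ and $\phi(x,z)-\phi(x,y)-\phi(x*y,z)+\phi(x*z,y*z)=0$ for all $x,y,z$. The shifting chain map $\sigma\colon C_*^Q(X)\to C_{*-1}^Q(X)$ is $\sigma_n=(-1)^n\partial_n^0$, and $\sigma^\sharp$ denotes pull-back of cochains along $\sigma$ (which sends cocycles to cocycles). **Generalized complex.** The associated group is $\mathrm{As}(X)=\langle x\ (x\in X)\mid x*y=y^{-1}xy\ (x,y\in X)\rangle$. An $X$-set is a set $Y$ with a right $\mathrm{As}(X)$-action; e.g. $\mathrm{As}(X)$ (right multiplication), $X$ with $y\cdot x=y*x$, and a singleton $\{y_0\}$. Let $C_n^R(X)_Y$ be free abelian on $Y\times X^n$ for $n\ge 0$ (on $Y$ if $n=0$), $0$ for $n<0$, with $\partial_n=\partial^0_n-\partial^1_n$, where for $n\ge1$ $$\partial_n^0(y;x_1,\dots,x_n)=\sum_{i=1}^n(-1)^i(y;x_1,\dots,x_{i-1},x_{i+1},\dots,x_n),$$ $$\partial_n^1(y;x_1,\dots,x_n)=\sum_{i=1}^n(-1)^i(y\cdot x_i;x_1*x_i,\dots,x_{i-1}*x_i,x_{i+1},\dots,x_n).$$ $C_n^Q(X)_Y$ is the quotient by the subgroup generated by $(y;x_1,\dots,x_n)$ with $x_i=x_{i+1}$ for some $i$; cochains, cocycles $Z_Q^n(X;A)_Y$ etc. are defined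 by applying $\mathrm{Hom}(-,A)$. **Fundamental quandle and class.** Let $D$ be a diagram of $L$ in $\mathbb{R}^2$, each arc carrying a normal vector indicating its orientation (by one fixed convention). The fundamental quandle $Q_D$ is generated by the arcs of $D$ with one relation $a_i*a_j=a_k$ at each crossing, where $a_j$ is the over arc and $a_i,a_k$ the under arcs, the normal of $a_j$ pointing from $a_i$ to $a_k$. Each complementary region of $D$ is assigned an element of $\mathrm{As}(Q_D)$ uniquely so that the unbounded region gets the identity and, if the normal of an arc $a$ points from region $r_1$ to $r_2$, then $r_1\cdot a=r_2$. For a crossing $\tau$ with sign $\varepsilon(\tau)\in\{\pm1\}$, let $r$ be the specified region (the one of the four regions around $\tau$ from which the normals of all arcs facing it point away), $x$ the under arc facing $r$, and $y$ the over arc. Put $|D|=\sum_\tau\varepsilon(\tau)(r;x,y)\in C_2^Q(Q_D)_{\mathrm{As}(Q_D)}$; it is a cycle, whose class is the fundamental class $[D]$. **Invariants.** For a finite quandle $X$, an $X$-set $Y$, $y\in Y$ and a $2$-cocycle $\lambda\in Z^2_Q(X;A)_Y$, set $$\Psi^y_\lambda(L)=\sum_{c\colon Q_D\to X}\langle s^y_*\circ c_*[D],[\lambda]\rangle\in\mathbb{Z}[A],$$ the sum over all quandle homomorphisms $c$ of the group-ring basis elements given by the Kronecker product. Here $c_*$ is induced by $(g;\boldsymbol{x})\mapsto(\mathrm{As}(c)(g);c(\boldsymbol{x}))$ and $s^y_*$ by $(g;\boldsymbol{x})\mapsto(y\cdot g;\boldsymbol{x})$. This is independent of the diagram $D$.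 The quandle cocycle invariant is $\Phi_\phi(L)=\Psi^{y_0}_\phi(L)$ with $Y=\{y_0\}$, identifying $(y_0;\boldsymbol{x})$ with $(\boldsymbol{x})$. The shadow cocycle invariant for $\theta\in Z_Q^3(X;A)$ and $x\in X$ is $\Phi^x_\theta(L)=\Psi^x_{\iota^\sharp\theta}(L)$ with $Y=X$, where $\iota\colon C_*^Q(X)_X\to C_{*+1}^Q(X)$ is the chain map $\iota_n(x_0;\boldsymbol{x})=(-1)^n(x_0,\boldsymbol{x})$ and $\iota^\sharp$ is its pull-back. *)

theory Defs
  imports "HOL-Analysis.Analysis" "HOL-Algebra.Group" "HOL-Library.Poly_Mapping"
begin

section \<open>Quandles\<close>

record 'q quandle_struct = "'q partial_object" +
  qop :: "'q \<Rightarrow> 'q \<Rightarrow> 'q" (infixl "\<triangleright>\<index>" 70)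

locale quandle =
  fixes X (structure)
  assumes qop_closed: "\<lbrakk>x \<in> carrier X; y \<in> carrier X\<rbrakk> \<Longrightarrow> x \<triangleright> y \<in> carrier X"
    and qop_idem: "x \<in> carrier X \<Longrightarrow> x \<triangleright> x = x"
    and qop_bij: "x \<in> carrier X \<Longrightarrow> bij_betw (\<lambda>y. y \<triangleright> x) (carrier X) (carrier X)"
    and qop_distrib: "\<lbrakk>x \<in> carrier X; y \<in> carrier X; z \<in> carrier X\<rbrakk>
           \<Longrightarrow> (x \<triangleright> y) \<triangleright> z = (x \<triangleright> z) \<triangleright> (y \<triangleright> z)"

text \<open>Homomorphisms are extensional, so that each one is a single HOL function and can be summed
  over.\<close>

definition quandle_homs ::
    "('q, 'm) quandle_struct_scheme \<Rightarrow> ('x, 'n) quandle_struct_scheme \<Rightarrow> ('q \<Rightarrow> 'x) set" where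
  "quandle_homs Q X = {c \<in> carrier Q \<rightarrow>\<^sub>E carrier X.
     \<forall>a\<in>carrier Q. \<forall>b\<in>carrier Q. c (a \<triangleright>\<^bsub>Q\<^esub> b) = c a \<triangleright>\<^bsub>X\<^esub> c b}"


section \<open>Quandles given by generators and relations\<close>

text \<open>\<open>QInv s t\<close> stands for the preimage of \<open>s\<close> under \<open>u \<mapsto> u \<triangleright> t\<close>.\<close>

datatype 'a qterm = QGen 'a | QOp "'a qterm" "'a qterm" | QInv "'a qterm" "'a qterm"

definition qterms :: "'a set \<Rightarrow> 'a qterm set" where
  "qterms S = {t. set_qterm t \<subseteq> S}"

inductive qterm_eq :: "'a set \<Rightarrow> ('a qterm \<times> 'a qterm) set \<Rightarrow> 'a qterm \<Rightarrow> 'a qterm \<Rightarrow> bool"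
  for S :: "'a set" and R :: "('a qterm \<times> 'a qterm) set" where
  refl: "s \<in> qterms S \<Longrightarrow> qterm_eq S R s s"
| sym: "qterm_eq S R s t \<Longrightarrow> qterm_eq S R t s"
| trans: "\<lbrakk>qterm_eq S R s t; qterm_eq S R t u\<rbrakk> \<Longrightarrow> qterm_eq S R s u"
| cong_op: "\<lbrakk>qterm_eq S R s s'; qterm_eq S R t t'\<rbrakk> \<Longrightarrow> qterm_eq S R (QOp s t) (QOp s' t')"
| cong_inv: "\<lbrakk>qterm_eq S R s s'; qterm_eq S R t t'\<rbrakk> \<Longrightarrow> qterm_eq S R (QInv s t) (QInv s' t')"
| idem: "s \<in> qterms S \<Longrightarrow> qterm_eq S R (QOp s s) s"
| op_inv: "\<lbrakk>s \<in> qterms S; t \<in> qterms S\<rbrakk> \<Longrightarrow> qterm_eq S R (QOp (QInv s t) t) s"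
| inv_op: "\<lbrakk>s \<in> qterms S; t \<in> qterms S\<rbrakk> \<Longrightarrow> qterm_eq S R (QInv (QOp s t) t) s"
| distrib: "\<lbrakk>s \<in> qterms S; t \<in> qterms S; u \<in> qterms S\<rbrakk>
     \<Longrightarrow> qterm_eq S R (QOp (QOp s t) u) (QOp (QOp s u) (QOp t u))"
| rel: "\<lbrakk>(s, t) \<in> R; s \<in> qterms S; t \<in> qterms S\<rbrakk> \<Longrightarrow> qterm_eq S R s t"

definition qpres :: "'a set \<Rightarrow> ('a qterm \<times> 'a qterm) set \<Rightarrow> 'a qterm set quandle_struct" where
  "qpres S R =
     \<lparr>carrier = qterms S // {(s, t). qterm_eq S R s t},
      qop = (\<lambda>A B. {u. \<exists>s\<in>A. \<exists>t\<in>B. qterm_eq S R (QOp s t) u})\<rparr>"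

definition qgen :: "'a set \<Rightarrow> ('a qterm \<times> 'a qterm) set \<Rightarrow> 'a \<Rightarrow> 'a qterm set" where
  "qgen S R a = {t. qterm_eq S R (QGen a) t}"


section \<open>The associated group and its actions\<close>

text \<open>In a word, the letter \<open>(x, True)\<close> is the generator \<open>x\<close> and \<open>(x, False)\<close> is its inverse.\<close>

type_synonym 'x qword = "('x \<times> bool) list"

definition qwords :: "('x, 'm) quandle_struct_scheme \<Rightarrow> 'x qword set" where
  "qwords X = lists (carrier X \<times> UNIV)"

inductive as_eq :: "('x, 'm) quandle_struct_scheme \<Rightarrow> 'x qword \<Rightarrow> 'x qword \<Rightarrow> bool"
  for X :: "('x, 'm) quandle_struct_scheme" where
  refl: "w \<in> qwords X \<Longrightarrow> as_eq X w w"
| sym: "as_eq X v w \<Longrightarrow> as_eq X w v"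
| trans: "\<lbrakk>as_eq X u v; as_eq X v w\<rbrakk> \<Longrightarrow> as_eq X u w"
| cong: "\<lbrakk>as_eq X v v'; as_eq X w w'\<rbrakk> \<Longrightarrow> as_eq X (v @ w) (v' @ w')"
| cancel: "x \<in> carrier X \<Longrightarrow> as_eq X [(x, b), (x, \<not> b)] []"
| rel: "\<lbrakk>x \<in> carrier X; y \<in> carrier X\<rbrakk>
     \<Longrightarrow> as_eq X [(x \<triangleright>\<^bsub>X\<^esub> y, True)] [(y, False), (x, True), (y, True)]"

definition As :: "('x, 'm) quandle_struct_scheme \<Rightarrow> 'x qword set monoid" where
  "As X =
     \<lparr>carrier = qwords X // {(v, w). as_eq X v w},
      monoid.mult = (\<lambda>g h. {w. \<exists>u\<in>g. \<exists>v\<in>h. as_eq X (u @ v) w}),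
      one = {w. as_eq X [] w}\<rparr>"

definition as_gen :: "('x, 'm) quandle_struct_scheme \<Rightarrow> 'x \<Rightarrow> 'x qword set" where
  "as_gen X x = {w. as_eq X [(x, True)] w}"

text \<open>The homomorphism of associated groups induced by a map \<open>c\<close> into \<open>X\<close>.\<close>

definition as_map :: "('x, 'm) quandle_struct_scheme \<Rightarrow> ('q \<Rightarrow> 'x) \<Rightarrow> 'q qword set \<Rightarrow> 'x qword set" where
  "as_map X c g = {w. \<exists>u\<in>g. as_eq X (map (apfst c) u) w}"

text \<open>The right action of \<open>As X\<close> on \<open>X\<close> with \<open>y \<cdot> x = y \<triangleright> x\<close>.\<close>

definition word_act :: "('x, 'm) quandle_struct_scheme \<Rightarrow> 'x \<Rightarrow> 'x qword \<Rightarrow> 'x" where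
  "word_act X y w =
     foldl (\<lambda>z (x, b). if b then z \<triangleright>\<^bsub>X\<^esub> x else inv_into (carrier X) (\<lambda>u. u \<triangleright>\<^bsub>X\<^esub> x) z) y w"

definition quandle_act :: "('x, 'm) quandle_struct_scheme \<Rightarrow> 'x \<Rightarrow> 'x qword set \<Rightarrow> 'x" where
  "quandle_act X y g = (THE z. \<exists>w\<in>g. z = word_act X y w)"

definition trivial_act :: "unit \<Rightarrow> 'x qword set \<Rightarrow> unit" where
  "trivial_act y g = y"


section \<open>Quandle chains and cochains\<close>

text \<open>Tuples in \<open>X\<^sup>n\<close> are lists of length \<open>n\<close>, chains are elements of the free abelian group
  \<open>_ \<Rightarrow>\<^sub>0 int\<close>. A homomorphism from a free abelian group to \<open>A\<close> is given by its values on the basis, and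
  \<open>pairing\<close> is its evaluation on a chain. A homomorphism from the quotient by the degenerate chains is
  one that vanishes on degenerate tuples, so for a cocycle \<open>f\<close> and a cycle represented by \<open>c\<close>,
  \<open>pairing f c\<close> is the Kronecker product of their classes.\<close>

definition int_mult :: "int \<Rightarrow> 'a::ab_group_add \<Rightarrow> 'a" where
  "int_mult k a = (if 0 \<le> k then (\<Sum>i<nat k. a) else - (\<Sum>i<nat (- k). a))"

definition pairing :: "('k \<Rightarrow> 'a::ab_group_add) \<Rightarrow> ('k \<Rightarrow>\<^sub>0 int) \<Rightarrow> 'a" where
  "pairing f c = (\<Sum>k\<in>Poly_Mapping.keys c. int_mult (Poly_Mapping.lookup c k) (f k))"

definition tuples :: "nat \<Rightarrow> ('x, 'm) quandle_struct_scheme \<Rightarrow> 'x list set" where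
  "tuples n X = {xs. length xs = n \<and> set xs \<subseteq> carrier X}"

definition degenerate :: "'x list \<Rightarrow> bool" where
  "degenerate xs \<longleftrightarrow> (\<exists>i. Suc i < length xs \<and> xs ! i = xs ! Suc i)"

text \<open>Values of the boundary maps on basis elements. List positions start at \<open>0\<close>, whence the sign
  \<open>(- 1) ^ Suc i\<close>.\<close>

definition bd0 :: "'x list \<Rightarrow> 'x list \<Rightarrow>\<^sub>0 int" where
  "bd0 xs = (if length xs \<le> 1 then 0 else
     (\<Sum>i<length xs. frag_cmul ((- 1) ^ Suc i) (frag_of (take i xs @ drop (Suc i) xs))))"

definition bd1 :: "('x, 'm) quandle_struct_scheme \<Rightarrow> 'x list \<Rightarrow> 'x list \<Rightarrow>\<^sub>0 int" where
  "bd1 X xs = (if length xs \<le> 1 then 0 else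
     (\<Sum>i<length xs. frag_cmul ((- 1) ^ Suc i)
        (frag_of (map (\<lambda>a. a \<triangleright>\<^bsub>X\<^esub> (xs ! i)) (take i xs) @ drop (Suc i) xs))))"

definition bd :: "('x, 'm) quandle_struct_scheme \<Rightarrow> 'x list \<Rightarrow> 'x list \<Rightarrow>\<^sub>0 int" where
  "bd X xs = bd0 xs - bd1 X xs"

definition cocycles :: "nat \<Rightarrow> ('x, 'm) quandle_struct_scheme \<Rightarrow> ('x list \<Rightarrow> 'a::ab_group_add) set" where
  "cocycles n X = {f.
     (\<forall>xs\<in>tuples n X. degenerate xs \<longrightarrow> f xs = 0) \<and>
     (\<forall>xs\<in>tuples (Suc n) X. pairing f (bd X xs) = 0)}"

definition shift_map :: "'x list \<Rightarrow> 'x list \<Rightarrow>\<^sub>0 int" where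
  "shift_map xs = frag_cmul ((- 1) ^ length xs) (bd0 xs)"

definition shift_pullback :: "('x list \<Rightarrow> 'a::ab_group_add) \<Rightarrow> 'x list \<Rightarrow> 'a" where
  "shift_pullback f xs = pairing f (shift_map xs)"

definition iota_map :: "'x \<times> 'x list \<Rightarrow> 'x list \<Rightarrow>\<^sub>0 int" where
  "iota_map = (\<lambda>(x0, xs). frag_cmul ((- 1) ^ length xs) (frag_of (x0 # xs)))"

definition iota_pullback :: "('x list \<Rightarrow> 'a::ab_group_add) \<Rightarrow> 'x \<times> 'x list \<Rightarrow> 'a" where
  "iota_pullback f p = pairing f (iota_map p)"


text \<open>The next lemmas confirm that these definitions give the familiar formulas in low degrees.\<close>

lemma int_mult_0 [simp]: "int_mult 0 a = 0"
  by (simp add: int_mult_def)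

lemma int_mult_1 [simp]: "int_mult 1 a = a"
  by (simp add: int_mult_def)

lemma int_mult_Suc: "int_mult (k + 1) a = int_mult k a + a"
proof (cases "0 \<le> k")
  case True
  then have "nat (k + 1) = Suc (nat k)"
    by simp
  with True show ?thesis
    by (simp add: int_mult_def)
next
  case False
  then have k: "nat (- k) = Suc (nat (- (k + 1)))"
    by simp
  with False show ?thesis
    by (cases "k = - 1") (auto simp add: int_mult_def)
qed

lemma int_mult_add: "int_mult (k + l) a = int_mult k a + int_mult l a"
proof (induction l rule: int_induct [where k = 0])
  case base
  show ?case by simp
next
  case (step1 i)
  then show ?case
    using int_mult_Suc [of "k + i" a] int_mult_Suc [of i a] by (simp add: add.assoc)
next
  case (step2 i)
  then show ?case
    using int_mult_Suc [of "k + (i - 1)" a] int_mult_Suc [of "i - 1" a]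
    by (simp add: algebra_simps)
qed

lemma pairing_superset:
  assumes "finite K" "Poly_Mapping.keys c \<subseteq> K"
  shows "pairing f c = (\<Sum>k\<in>K. int_mult (Poly_Mapping.lookup c k) (f k))"
  unfolding pairing_def using assms
  by (intro sum.mono_neutral_left) (auto simp: in_keys_iff)

lemma pairing_0 [simp]: "pairing f 0 = 0"
  by (simp add: pairing_def)

lemma pairing_frag_of [simp]: "pairing f (frag_of k) = f k"
  by (simp add: pairing_def)

lemma pairing_add [simp]: "pairing f (c + d) = pairing f c + pairing f d"
proof -
  let ?K = "Poly_Mapping.keys c \<union> Poly_Mapping.keys d"
  have "pairing f (c + d) = (\<Sum>k\<in>?K. int_mult (Poly_Mapping.lookup (c + d) k) (f k))"
    by (rule pairing_superset) (auto dest: subsetD [OF keys_add])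
  also have "\<dots> = (\<Sum>k\<in>?K. int_mult (Poly_Mapping.lookup c k) (f k))
      + (\<Sum>k\<in>?K. int_mult (Poly_Mapping.lookup d k) (f k))"
    by (simp add: lookup_add int_mult_add sum.distrib)
  also have "\<dots> = pairing f c + pairing f d"
    by (simp add: pairing_superset [of ?K])
  finally show ?thesis .
qed

lemma pairing_minus [simp]: "pairing f (- c) = - pairing f c"
  using pairing_add [of f c "- c"] by (simp add: eq_neg_iff_add_eq_0 add.commute)

lemma pairing_diff [simp]: "pairing f (c - d) = pairing f c - pairing f d"
  using pairing_add [of f c "- d"] by simp

lemma bd_3:
  "bd X [x, y, z] = frag_of [x, z] - frag_of [x, y]
     - frag_of [x \<triangleright>\<^bsub>X\<^esub> y, z] + frag_of [x \<triangleright>\<^bsub>X\<^esub> z, y \<triangleright>\<^bsub>X\<^esub> z]"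
  by (simp add: bd_def bd0_def bd1_def eval_nat_numeral)

lemma degenerate_Cons_Cons: "degenerate (x # y # xs) \<longleftrightarrow> x = y \<or> degenerate (y # xs)"
proof -
  have "degenerate (x # y # xs) \<longleftrightarrow>
      (\<exists>i. i < Suc (length xs) \<and> (x # y # xs) ! i = (y # xs) ! i)"
    by (simp add: degenerate_def)
  also have "\<dots> \<longleftrightarrow> x = y \<or> (\<exists>i < length xs. (y # xs) ! i = xs ! i)"
    by (subst Ex_less_Suc2) simp
  finally show ?thesis
    by (simp add: degenerate_def)
qed

lemma not_degenerate_singleton: "\<not> degenerate [x]"
  by (simp add: degenerate_def)

lemma tuples_Suc: "xs \<in> tuples (Suc n) X \<longleftrightarrow> (\<exists>y ys. xs = y # ys \<and> y \<in> carrier X \<and> ys \<in> tuples n X)"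
  by (auto simp: tuples_def length_Suc_conv)

lemma tuples_0: "xs \<in> tuples 0 X \<longleftrightarrow> xs = []"
  by (auto simp: tuples_def)

lemma cocycles_2_iff:
  "f \<in> cocycles 2 X \<longleftrightarrow>
     (\<forall>x\<in>carrier X. f [x, x] = 0) \<and>
     (\<forall>x\<in>carrier X. \<forall>y\<in>carrier X. \<forall>z\<in>carrier X.
        f [x, z] - f [x, y] - f [x \<triangleright>\<^bsub>X\<^esub> y, z] + f [x \<triangleright>\<^bsub>X\<^esub> z, y \<triangleright>\<^bsub>X\<^esub> z] = 0)"
proof -
  have 2: "xs \<in> tuples 2 X \<longleftrightarrow> (\<exists>x\<in>carrier X. \<exists>y\<in>carrier X. xs = [x, y])" for xs
    by (auto simp: eval_nat_numeral tuples_Suc tuples_0)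
  have 3: "xs \<in> tuples (Suc 2) X \<longleftrightarrow>
      (\<exists>x\<in>carrier X. \<exists>y\<in>carrier X. \<exists>z\<in>carrier X. xs = [x, y, z])" for xs
    by (simp only: tuples_Suc [of xs 2 X] 2) blast
  have "(\<forall>xs\<in>tuples 2 X. degenerate xs \<longrightarrow> f xs = 0) \<longleftrightarrow> (\<forall>x\<in>carrier X. f [x, x] = 0)"
    by (auto simp: 2 degenerate_Cons_Cons not_degenerate_singleton)
  moreover have "(\<forall>xs\<in>tuples (Suc 2) X. pairing f (bd X xs) = 0) \<longleftrightarrow>
     (\<forall>x\<in>carrier X. \<forall>y\<in>carrier X. \<forall>z\<in>carrier X. pairing f (bd X [x, y, z]) = 0)"
    unfolding Ball_def 3 by blast
  ultimately show ?thesis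
    by (simp add: cocycles_def bd_3)
qed

lemma shift_pullback_3: "shift_pullback f [x, y, z] = f [y, z] - f [x, z] + f [x, y]"
  by (simp add: shift_pullback_def shift_map_def bd0_def eval_nat_numeral)

lemma shift_pullback_cocycle:
  fixes X (structure)
  assumes "quandle X" "f \<in> cocycles 2 X"
  shows "shift_pullback f \<in> cocycles 3 X"
proof -
  interpret quandle X by fact
  have d: "f [x, x] = 0" if "x \<in> carrier X" for x
    using assms(2) that by (simp add: cocycles_2_iff)
  have c: "f [x \<triangleright> z, y \<triangleright> z] = f [x, y] + f [x \<triangleright> y, z] - f [x, z]"
    if "x \<in> carrier X" "y \<in> carrier X" "z \<in> carrier X" for x y z
  proof -
    have "f [x, z] - f [x, y] - f [x \<triangleright> y, z] + f [x \<triangleright> z, y \<triangleright> z] = 0"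
      using assms(2) that by (simp add: cocycles_2_iff)
    then have "f [x \<triangleright> z, y \<triangleright> z] = - (f [x, z] - f [x, y] - f [x \<triangleright> y, z])"
      by (metis add.commute eq_neg_iff_add_eq_0)
    then show ?thesis
      by (simp add: algebra_simps)
  qed
  have "shift_pullback f xs = 0" if "xs \<in> tuples 3 X" "degenerate xs" for xs
    using that by (auto simp: eval_nat_numeral tuples_Suc tuples_0 degenerate_Cons_Cons
        not_degenerate_singleton shift_pullback_3 d)
  moreover have "pairing (shift_pullback f) (bd X xs) = 0" if "xs \<in> tuples (Suc 3) X" for xs
  proof -
    from that obtain x y z w where "xs = [x, y, z, w]" and
      "x \<in> carrier X" "y \<in> carrier X" "z \<in> carrier X" "w \<in> carrier X"
      by (auto simp: eval_nat_numeral tuples_Suc tuples_0)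
    then show ?thesis
      by (simp add: bd_def bd0_def bd1_def eval_nat_numeral shift_pullback_3 c)
  qed
  ultimately show ?thesis
    by (simp add: cocycles_def)
qed

lemma iota_pullback_2: "iota_pullback f (x0, [x, y]) = f [x0, x, y]"
  by (simp add: iota_pullback_def iota_map_def)


section \<open>Oriented links\<close>

text \<open>An oriented link is given by parametrizations of its components, each traversed in the
  direction of its orientation.\<close>

definition oriented_link :: "(real \<Rightarrow> real^3) list \<Rightarrow> bool" where
  "oriented_link L \<longleftrightarrow>
     (\<forall>p\<in>set L. simple_path p \<and> pathfinish p = pathstart p) \<and>
     (\<forall>i<length L. \<forall>j<length L. i \<noteq> j \<longrightarrow> path_image (L ! i) \<inter> path_image (L ! j) = {})"

text \<open>\<open>q\<close> is an orientation-preserving reparametrization of the closed curve \<open>p\<close>; \<open>f\<close> is a lift to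
  the real line of the change of parameter on the circle.\<close>

definition same_oriented_curve :: "(real \<Rightarrow> 'b::topological_space) \<Rightarrow> (real \<Rightarrow> 'b) \<Rightarrow> bool" where
  "same_oriented_curve p q \<longleftrightarrow>
     (\<exists>f :: real \<Rightarrow> real. continuous_on UNIV f \<and> strict_mono f \<and> (\<forall>t. f (t + 1) = f t + 1) \<and>
        (\<forall>t\<in>{0..1}. q t = p (frac (f t))))"

definition ambient_isotopic :: "(real \<Rightarrow> real^3) list \<Rightarrow> (real \<Rightarrow> real^3) list \<Rightarrow> bool" where
  "ambient_isotopic L M \<longleftrightarrow>
     (\<exists>H :: real \<Rightarrow> real^3 \<Rightarrow> real^3.
        continuous_on ({0..1} \<times> UNIV) (\<lambda>(t, x). H t x) \<and>
        (\<forall>t\<in>{0..1}. \<exists>G. homeomorphism UNIV UNIV (H t) G) \<and>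
        (\<forall>x. H 0 x = x) \<and>
        list_all2 (\<lambda>p q. same_oriented_curve (H 1 \<circ> p) q) L M)"


section \<open>Link diagrams\<close>

text \<open>A diagram is stored as a polygonal link in \<open>\<real>\<^sup>3\<close> in general position with respect to the
  projection \<open>proj\<close> to the first two coordinates, so that it carries the over-under information; the
  plane \<open>\<real>\<^sup>2\<close> is identified with the complex plane. A component is the cyclic list of its vertices. The
  pair \<open>(i, j)\<close> denotes the edge of the \<open>i\<close>-th component that starts at its \<open>j\<close>-th vertex.\<close>

type_synonym polylink = "(real^3) list list"
type_synonym edge = "nat \<times> nat"

definition proj :: "real^3 \<Rightarrow> complex" where
  "proj p = Complex (p $ 1) (p $ 2)"

definition height :: "real^3 \<Rightarrow> real" where
  "height p = p $ 3"

definition edges :: "polylink \<Rightarrow> edge set" where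
  "edges D = {(i, j). i < length D \<and> j < length (D ! i)}"

fun next_edge :: "polylink \<Rightarrow> edge \<Rightarrow> edge" where
  "next_edge D (i, j) = (i, Suc j mod length (D ! i))"

fun source :: "polylink \<Rightarrow> edge \<Rightarrow> real^3" where
  "source D (i, j) = D ! i ! j"

definition target :: "polylink \<Rightarrow> edge \<Rightarrow> real^3" where
  "target D e = source D (next_edge D e)"

definition edge_points :: "polylink \<Rightarrow> edge \<Rightarrow> (real^3) set" where
  "edge_points D e = closed_segment (source D e) (target D e)"

definition link_points :: "polylink \<Rightarrow> (real^3) set" where
  "link_points D = (\<Union>e\<in>edges D. edge_points D e)"

text \<open>The conditions say, in this order: components are polygons; no edge is vertical; the projection
  of a vertex lies only on the two edges incident to it, in particular projected edges cannot overlap;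
  there are no triple points; and the link is embedded in \<open>\<real>\<^sup>3\<close>. Hence the projection is an immersion
  whose only singularities are finitely many transverse double points in the interior of edges.\<close>

definition regular_diagram :: "polylink \<Rightarrow> bool" where
  "regular_diagram D \<longleftrightarrow>
     (\<forall>vs\<in>set D. 3 \<le> length vs) \<and>
     (\<forall>e\<in>edges D. proj (source D e) \<noteq> proj (target D e)) \<and>
     (\<forall>e\<in>edges D. \<forall>f\<in>edges D.
        proj (target D e) \<in> proj ` edge_points D f \<longrightarrow> f = e \<or> f = next_edge D e) \<and>
     (\<forall>e\<in>edges D. \<forall>f\<in>edges D. \<forall>g\<in>edges D. e \<noteq> f \<and> f \<noteq> g \<and> e \<noteq> g \<longrightarrow>
        proj ` edge_points D e \<inter> proj ` edge_points D f \<inter> proj ` edge_points D g = {}) \<and>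
     (\<forall>e\<in>edges D. \<forall>f\<in>edges D.
        edge_points D e \<inter> edge_points D f \<noteq> {} \<longrightarrow> f = e \<or> f = next_edge D e \<or> e = next_edge D f)"

text \<open>The closed curve through the vertices, each edge being traversed in time \<open>1 / length vs\<close>.\<close>

definition polygon_path :: "(real^3) list \<Rightarrow> real \<Rightarrow> real^3" where
  "polygon_path vs t =
     (let n = length vs; s = t * real n; j = nat \<lfloor>s\<rfloor>
      in linepath (vs ! (j mod n)) (vs ! (Suc j mod n)) (frac s))"

definition diagram_of :: "polylink \<Rightarrow> (real \<Rightarrow> real^3) list \<Rightarrow> bool" where
  "diagram_of D L \<longleftrightarrow> regular_diagram D \<and> ambient_isotopic L (map polygon_path D)"

text \<open>A crossing is a pair \<open>(e, f)\<close> of the edge \<open>e\<close> passing over and the edge \<open>f\<close> passing under.\<close>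

type_synonym crossing = "edge \<times> edge"

definition crossings :: "polylink \<Rightarrow> crossing set" where
  "crossings D = {(e, f). e \<in> edges D \<and> f \<in> edges D \<and>
     (\<exists>p\<in>edge_points D e. \<exists>q\<in>edge_points D f. proj p = proj q \<and> height p > height q)}"

definition over_point :: "polylink \<Rightarrow> crossing \<Rightarrow> real^3" where
  "over_point D \<tau> = (THE p. p \<in> edge_points D (fst \<tau>) \<and> proj p \<in> proj ` edge_points D (snd \<tau>))"

definition under_point :: "polylink \<Rightarrow> crossing \<Rightarrow> real^3" where
  "under_point D \<tau> = (THE q. q \<in> edge_points D (snd \<tau>) \<and> proj q \<in> proj ` edge_points D (fst \<tau>))"

definition cut_link :: "polylink \<Rightarrow> (real^3) set" where
  "cut_link D = link_points D - under_point D ` crossings D"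

text \<open>The arcs are the pieces into which the link is cut at the undercrossings, taken in \<open>\<real>\<^sup>3\<close>, where
  they are disjoint.\<close>

definition arcs :: "polylink \<Rightarrow> (real^3) set set" where
  "arcs D = components (cut_link D)"

definition arc_at :: "polylink \<Rightarrow> real^3 \<Rightarrow> (real^3) set" where
  "arc_at D p = connected_component_set (cut_link D) p"

definition direction :: "polylink \<Rightarrow> edge \<Rightarrow> real^3" where
  "direction D e = target D e - source D e"

text \<open>Convention: the normal is the unit tangent turned by a quarter turn counterclockwise.\<close>

definition normal :: "polylink \<Rightarrow> edge \<Rightarrow> complex" where
  "normal D e = \<i> * sgn (proj (direction D e))"

text \<open>The sign is positive iff the directions of the over and the under strand, in this order, form
  a positively oriented basis of the plane.\<close>

definition crossing_sign :: "polylink \<Rightarrow> crossing \<Rightarrow> int" where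
  "crossing_sign D \<tau> =
     (if Im (cnj (proj (direction D (fst \<tau>))) * proj (direction D (snd \<tau>))) > 0 then 1 else - 1)"

definition over_arc :: "polylink \<Rightarrow> crossing \<Rightarrow> (real^3) set" where
  "over_arc D \<tau> = arc_at D (over_point D \<tau>)"

text \<open>The under arc on the side that the normal of the over arc points away from, respectively
  towards; \<open>d\<close> points from the crossing into the arc.\<close>

definition under_arc_from :: "polylink \<Rightarrow> crossing \<Rightarrow> (real^3) set" where
  "under_arc_from D \<tau> = (THE a. a \<in> arcs D \<and>
     (\<exists>d\<in>{direction D (snd \<tau>), - direction D (snd \<tau>)}. inner (normal D (fst \<tau>)) (proj d) < 0 \<and>
        (\<forall>\<^sub>F s in at_right 0. under_point D \<tau> + s *\<^sub>R d \<in> a)))"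

definition under_arc_to :: "polylink \<Rightarrow> crossing \<Rightarrow> (real^3) set" where
  "under_arc_to D \<tau> = (THE a. a \<in> arcs D \<and>
     (\<exists>d\<in>{direction D (snd \<tau>), - direction D (snd \<tau>)}. inner (normal D (fst \<tau>)) (proj d) > 0 \<and>
        (\<forall>\<^sub>F s in at_right 0. under_point D \<tau> + s *\<^sub>R d \<in> a)))"


section \<open>The fundamental quandle and the fundamental class\<close>

definition diagram_relations :: "polylink \<Rightarrow> ((real^3) set qterm \<times> (real^3) set qterm) set" where
  "diagram_relations D =
     (\<lambda>\<tau>. (QOp (QGen (under_arc_from D \<tau>)) (QGen (over_arc D \<tau>)), QGen (under_arc_to D \<tau>)))
       ` crossings D"

type_synonym qd_elem = "(real^3) set qterm set"

definition fundamental_quandle :: "polylink \<Rightarrow> qd_elem quandle_struct" where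
  "fundamental_quandle D = qpres (arcs D) (diagram_relations D)"

definition arc_gen :: "polylink \<Rightarrow> (real^3) set \<Rightarrow> qd_elem" where
  "arc_gen D a = qgen (arcs D) (diagram_relations D) a"

definition regions :: "polylink \<Rightarrow> complex set set" where
  "regions D = components (- proj ` link_points D)"

text \<open>\<open>\<rho>\<close> is the assignment of elements of the associated group of the fundamental quandle to the
  regions. It is determined uniquely on the regions by these conditions.\<close>

definition region_labelling :: "polylink \<Rightarrow> (complex set \<Rightarrow> qd_elem qword set) \<Rightarrow> bool" where
  "region_labelling D \<rho> \<longleftrightarrow>
     \<rho> \<in> regions D \<rightarrow> carrier (As (fundamental_quandle D)) \<and>
     (\<forall>r\<in>regions D. \<not> bounded r \<longrightarrow> \<rho> r = \<one>\<^bsub>As (fundamental_quandle D)\<^esub>) \<and>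
     (\<forall>e\<in>edges D. \<forall>p\<in>open_segment (source D e) (target D e). \<forall>r1\<in>regions D. \<forall>r2\<in>regions D.
        proj p \<notin> proj ` under_point D ` crossings D \<longrightarrow>
        (\<forall>\<^sub>F s in at_right 0. proj p - s *\<^sub>R normal D e \<in> r1 \<and> proj p + s *\<^sub>R normal D e \<in> r2) \<longrightarrow>
        \<rho> r2 = \<rho> r1 \<otimes>\<^bsub>As (fundamental_quandle D)\<^esub>
                 as_gen (fundamental_quandle D) (arc_gen D (arc_at D p)))"

text \<open>The specified region: both unit normals at the crossing point away from it.\<close>

definition specified_region :: "polylink \<Rightarrow> crossing \<Rightarrow> complex set" where
  "specified_region D \<tau> = (THE r. r \<in> regions D \<and>
     (\<forall>\<^sub>F s in at_right 0.
        proj (under_point D \<tau>) - s *\<^sub>R (normal D (fst \<tau>) + normal D (snd \<tau>)) \<in> r))"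

text \<open>The cycle \<open>|D|\<close>. The under arc facing the specified region is the one on the side that the
  normal of the over arc points away from.\<close>

definition fundamental_cycle ::
    "polylink \<Rightarrow> (complex set \<Rightarrow> qd_elem qword set) \<Rightarrow> (qd_elem qword set \<times> qd_elem list) \<Rightarrow>\<^sub>0 int" where
  "fundamental_cycle D \<rho> =
     (\<Sum>\<tau>\<in>crossings D. frag_cmul (crossing_sign D \<tau>)
        (frag_of (\<rho> (specified_region D \<tau>),
                  [arc_gen D (under_arc_from D \<tau>), arc_gen D (over_arc D \<tau>)])))"


section \<open>The invariants\<close>

definition induced_chain_map ::
    "('x, 'm) quandle_struct_scheme \<Rightarrow> ('q \<Rightarrow> 'x) \<Rightarrow>
       (('q qword set \<times> 'q list) \<Rightarrow>\<^sub>0 int) \<Rightarrow> (('x qword set \<times> 'x list) \<Rightarrow>\<^sub>0 int)" where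
  "induced_chain_map X c = frag_extend (\<lambda>(g, xs). frag_of (as_map X c g, map c xs))"

definition orbit_chain_map ::
    "('y \<Rightarrow> 'x qword set \<Rightarrow> 'y) \<Rightarrow> 'y \<Rightarrow>
       (('x qword set \<times> 'x list) \<Rightarrow>\<^sub>0 int) \<Rightarrow> (('y \<times> 'x list) \<Rightarrow>\<^sub>0 int)" where
  "orbit_chain_map act y = frag_extend (\<lambda>(g, xs). frag_of (act y g, xs))"

text \<open>The integral group ring of \<open>'a\<close> is \<open>'a \<Rightarrow>\<^sub>0 int\<close>, with basis elements \<open>frag_of a\<close>. The right
  action \<open>act\<close> of \<open>As X\<close> makes the type \<open>'y\<close> (or a subset containing \<open>y\<close>) an \<open>X\<close>-set.\<close>

definition Psi ::
    "polylink \<Rightarrow> (complex set \<Rightarrow> qd_elem qword set) \<Rightarrow> ('x, 'm) quandle_struct_scheme \<Rightarrow>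
       ('y \<Rightarrow> 'x qword set \<Rightarrow> 'y) \<Rightarrow> 'y \<Rightarrow> ('y \<times> 'x list \<Rightarrow> 'a::ab_group_add) \<Rightarrow> 'a \<Rightarrow>\<^sub>0 int" where
  "Psi D \<rho> X act y f =
     (\<Sum>c\<in>quandle_homs (fundamental_quandle D) X.
        frag_of (pairing f (orbit_chain_map act y (induced_chain_map X c (fundamental_cycle D \<rho>)))))"

definition quandle_cocycle_invariant ::
    "polylink \<Rightarrow> (complex set \<Rightarrow> qd_elem qword set) \<Rightarrow> ('x, 'm) quandle_struct_scheme \<Rightarrow>
       ('x list \<Rightarrow> 'a::ab_group_add) \<Rightarrow> 'a \<Rightarrow>\<^sub>0 int" where
  "quandle_cocycle_invariant D \<rho> X \<phi> = Psi D \<rho> X trivial_act () (\<lambda>(_, xs). \<phi> xs)"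

definition shadow_cocycle_invariant ::
    "polylink \<Rightarrow> (complex set \<Rightarrow> qd_elem qword set) \<Rightarrow> ('x, 'm) quandle_struct_scheme \<Rightarrow> 'x \<Rightarrow>
       ('x list \<Rightarrow> 'a::ab_group_add) \<Rightarrow> 'a \<Rightarrow>\<^sub>0 int" where
  "shadow_cocycle_invariant D \<rho> X x \<theta> = Psi D \<rho> X (quandle_act X) x (iota_pullback \<theta>)"

end

theory Submission
  imports Defs
begin

text \<open>For a colouring \<open>c\<close> of the diagram let \<open>z\<close> be the colour of the specified region of a crossing
  \<open>\<tau>\<close>, \<open>a\<close> the colour of the under arc facing it and \<open>b\<close> the colour of the over arc. The shadow weight
  of \<open>\<tau>\<close> is \<open>\<plusminus> (\<phi> (a, b) - \<phi> (z, b) + \<phi> (z, a))\<close>, so the two invariants agree as soon as the signed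
  sum of \<open>\<phi> (z, a) - \<phi> (z, b)\<close> over the crossings vanishes. This happens for each colouring separately.

  Because \<open>\<phi>\<close> is a cocycle, \<open>(z, \<alpha>) \<cdot> y = (z \<triangleright> y, \<alpha> + \<phi> (z, y))\<close> defines an action of the associated
  group of \<open>X\<close> on \<open>X \<times> A\<close> (\<open>ext_act_as_eq\<close>). Let the label of a region act on \<open>(x, 0)\<close>: the first
  component of the result is the colour of the region, the second is a weight \<open>\<alpha>\<close>. Crossing an arc
  of colour \<open>y\<close> in the direction of its normal from a region of colour \<open>z\<close> adds \<open>\<phi> (z, y)\<close> to the
  weight. Hence \<open>\<phi> (z, a) - \<phi> (z, b)\<close> is the difference of the weights of the two regions that lie on
  the left of one strand of the crossing and on the right of the other one.

  It remains to see that for any function \<open>\<alpha>\<close> on the regions the signed sum of these differences is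
  zero (\<open>sum_opposite_quadrants\<close>). Follow the components of the link and record \<open>\<alpha>\<close> of the region on
  the left. Around each closed component the jumps of this step function add up to zero. Each crossing
  is passed twice, and the sum of its two jumps is, up to sign, the difference in question: with
  both strands directed upwards, the left region of one strand changes from the lower to the left one,
  that of the other strand from the left to the upper one, so that together the jumps amount to
  \<open>\<alpha> (upper) - \<alpha> (lower)\<close>.

  The geometric part makes this precise. Two edges meet transversally (\<open>double_point_transverse\<close>), so
  near a crossing the complement of the diagram consists of four convex sectors (\<open>quadrant\<close>), and the
  left region is locally constant away from crossings, also around the corners of the polygons
  (\<open>left_region_at_vertex\<close>).\<close>

section \<open>Evaluating a cochain on the fundamental cycle\<close>

lemma int_mult_distrib: "int_mult k (a + b) = int_mult k a + int_mult k b"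
  by (simp add: int_mult_def sum.distrib)

lemma int_mult_minus_1 [simp]: "int_mult (- 1) a = - a"
  by (simp add: int_mult_def)

lemma pairing_cmul_frag_of [simp]: "pairing f (frag_cmul k (frag_of x)) = int_mult k (f x)"
  by (subst pairing_superset [of "{x}"]) (auto simp: keys_cmul_iff)

lemma pairing_sum: "finite I \<Longrightarrow> pairing f (sum c I) = (\<Sum>i\<in>I. pairing f (c i))"
  by (induction I rule: finite_induct) auto

lemma pairing_fundamental_cycle:
  assumes "finite (crossings D)"
  shows "pairing f (orbit_chain_map act y (induced_chain_map X c (fundamental_cycle D \<rho>))) =
    (\<Sum>\<tau>\<in>crossings D. int_mult (crossing_sign D \<tau>)
      (f (act y (as_map X c (\<rho> (specified_region D \<tau>))),
          [c (arc_gen D (under_arc_from D \<tau>)), c (arc_gen D (over_arc D \<tau>))])))"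
  using assms
  by (simp add: fundamental_cycle_def induced_chain_map_def orbit_chain_map_def
      frag_extend_sum frag_extend_cmul pairing_sum)


section \<open>The action of the associated group on the extension by a cocycle\<close>

text \<open>The right action on \<open>X \<times> A\<close> in which the generator \<open>y\<close> sends \<open>(z, \<alpha>)\<close> to \<open>(z \<triangleright> y, \<alpha> + \<phi> (z, y))\<close>,
  first letter by letter and then for words. The inverse of a generator has to subtract the value
  of \<open>\<phi>\<close> at the preimage of \<open>z\<close>.\<close>

definition ext_step ::
    "('x, 'm) quandle_struct_scheme \<Rightarrow> ('x list \<Rightarrow> 'a::ab_group_add) \<Rightarrow> 'x \<times> 'a \<Rightarrow> 'x \<times> bool \<Rightarrow> 'x \<times> 'a" where
  "ext_step X \<phi> = (\<lambda>(z, \<alpha>) (y, b).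
     if b then (z \<triangleright>\<^bsub>X\<^esub> y, \<alpha> + \<phi> [z, y])
     else let z' = inv_into (carrier X) (\<lambda>u. u \<triangleright>\<^bsub>X\<^esub> y) z in (z', \<alpha> - \<phi> [z', y]))"

definition ext_act ::
    "('x, 'm) quandle_struct_scheme \<Rightarrow> ('x list \<Rightarrow> 'a::ab_group_add) \<Rightarrow> 'x \<times> 'a \<Rightarrow> 'x qword \<Rightarrow> 'x \<times> 'a" where
  "ext_act X \<phi> = foldl (ext_step X \<phi>)"

lemma ext_act_simps [simp]:
  "ext_act X \<phi> p [] = p"
  "ext_act X \<phi> p (l # w) = ext_act X \<phi> (ext_step X \<phi> p l) w"
  "ext_act X \<phi> p (v @ w) = ext_act X \<phi> (ext_act X \<phi> p v) w"
  by (simp_all add: ext_act_def)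

lemma fst_ext_act: "fst (ext_act X \<phi> p w) = word_act X (fst p) w"
  by (induction w arbitrary: p) (auto simp: ext_step_def word_act_def Let_def split: prod.split)

context quandle
begin

lemma inv_qop:
  assumes "y \<in> carrier X" "z \<in> carrier X"
  shows "inv_into (carrier X) (\<lambda>u. u \<triangleright> y) z \<in> carrier X"
    and "inv_into (carrier X) (\<lambda>u. u \<triangleright> y) z \<triangleright> y = z"
    and "inv_into (carrier X) (\<lambda>u. u \<triangleright> y) (z \<triangleright> y) = z"
  using qop_bij [OF assms(1)] assms
    bij_betw_inv_into [OF qop_bij [OF assms(1)], THEN bij_betwE]
    bij_betw_inv_into_right [OF qop_bij [OF assms(1)], of z]
    bij_betw_inv_into_left [OF qop_bij [OF assms(1)], of z]
  by auto

lemma as_eq_qwords: "as_eq X v w \<Longrightarrow> v \<in> qwords X \<and> w \<in> qwords X"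
  by (induction rule: as_eq.induct) (auto simp: qwords_def qop_closed)

lemma fst_ext_act_closed:
  "\<lbrakk>fst p \<in> carrier X; w \<in> qwords X\<rbrakk> \<Longrightarrow> fst (ext_act X \<phi> p w) \<in> carrier X"
proof (induction w arbitrary: p)
  case (Cons l w)
  obtain z \<alpha> y b where "p = (z, \<alpha>)" "l = (y, b)"
    by (meson surj_pair)
  with Cons show ?case
    by (auto simp: qwords_def ext_step_def Let_def qop_closed inv_qop intro!: Cons.IH)
qed simp

text \<open>Words that represent the same element of the associated group act in the same way. For the defining
  relation of \<open>x \<triangleright> y\<close> this is exactly the cocycle condition, at the triple that consists of
  the preimage of \<open>z\<close> under \<open>y\<close>, of \<open>x\<close> and of \<open>y\<close>.\<close>

lemma ext_act_as_eq:
  assumes \<phi>: "\<phi> \<in> cocycles 2 X" and "as_eq X v w" and "fst p \<in> carrier X"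
  shows "ext_act X \<phi> p v = ext_act X \<phi> p w"
  using assms(2,3)
proof (induction arbitrary: p rule: as_eq.induct)
  case (cong v v' w w')
  then show ?case
    using as_eq_qwords fst_ext_act_closed by (metis ext_act_simps(3))
next
  case (cancel y b)
  obtain z \<alpha> where "p = (z, \<alpha>)" by fastforce
  with cancel show ?case
    by (cases b) (auto simp: ext_step_def Let_def inv_qop)
next
  case (rel x y)
  obtain z \<alpha> where p: "p = (z, \<alpha>)" by fastforce
  define z' where "z' = inv_into (carrier X) (\<lambda>u. u \<triangleright> y) z"
  have z': "z' \<in> carrier X" "z' \<triangleright> y = z"
    using inv_qop rel p by (simp_all add: z'_def)
  have "\<phi> [z', y] - \<phi> [z', x] - \<phi> [z' \<triangleright> x, y] + \<phi> [z' \<triangleright> y, x \<triangleright> y] = 0"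
    using \<phi> z'(1) rel unfolding cocycles_2_iff by blast
  then have "\<phi> [z, x \<triangleright> y] = - \<phi> [z', y] + \<phi> [z', x] + \<phi> [z' \<triangleright> x, y]"
    by (simp add: z' algebra_simps add_eq_0_iff)
  then show ?case
    using qop_distrib [of z' x y] z' rel
    by (simp add: p ext_step_def Let_def flip: z'_def)
qed auto

lemma map_hom_qwords: "\<lbrakk>c \<in> quandle_homs Q X; w \<in> qwords Q\<rbrakk> \<Longrightarrow> map (apfst c) w \<in> qwords X"
  by (fastforce simp: qwords_def quandle_homs_def)

lemma as_eq_map:
  assumes c: "c \<in> quandle_homs Q X" and "as_eq Q v w"
  shows "as_eq X (map (apfst c) v) (map (apfst c) w)"
  using assms(2)
proof (induction rule: as_eq.induct)
  case (refl w)
  then show ?case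
    using map_hom_qwords [OF c] by (auto intro: as_eq.refl)
next
  case (cong v v' w w')
  then show ?case by (simp add: as_eq.cong)
next
  case (cancel x b)
  then show ?case
    using c as_eq.cancel [of "c x" X b] by (auto simp: quandle_homs_def)
next
  case (rel x y)
  then show ?case
    using c as_eq.rel [of "c x" X "c y"] by (auto simp: quandle_homs_def)
qed (auto intro: as_eq.intros)

end

text \<open>The image of \<open>(x, 0)\<close> under the element that \<open>c\<close> induces from \<open>g\<close>; by \<open>ext_colour_eq\<close> the word
  chosen to represent \<open>g\<close> does not matter.\<close>

definition ext_colour ::
    "('x, 'm) quandle_struct_scheme \<Rightarrow> ('x list \<Rightarrow> 'a::ab_group_add) \<Rightarrow> 'x \<Rightarrow> ('q \<Rightarrow> 'x) \<Rightarrow>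
       'q qword set \<Rightarrow> 'x \<times> 'a" where
  "ext_colour X \<phi> x c g = ext_act X \<phi> (x, 0) (map (apfst c) (SOME u. u \<in> g))"

lemma As_carrierE:
  assumes "g \<in> carrier (As Q)"
  obtains u where "u \<in> qwords Q" "u \<in> g" "\<And>v. v \<in> g \<longleftrightarrow> as_eq Q u v"
  using assms by (fastforce simp: As_def quotient_def intro: as_eq.refl)

context quandle
begin

context
  fixes \<phi> :: "'a list \<Rightarrow> 'g::ab_group_add" and x :: 'a
    and Q :: "('q, 'n) quandle_struct_scheme" and c :: "'q \<Rightarrow> 'a"
  assumes \<phi>: "\<phi> \<in> cocycles 2 X" and x: "x \<in> carrier X" and c: "c \<in> quandle_homs Q X"
begin

lemma ext_colour_eq:
  assumes "g \<in> carrier (As Q)" "u \<in> g"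
  shows "ext_colour X \<phi> x c g = ext_act X \<phi> (x, 0) (map (apfst c) u)"
proof -
  obtain w where w: "\<And>v. v \<in> g \<longleftrightarrow> as_eq Q w v"
    using assms(1) by (auto elim: As_carrierE)
  have "(SOME u. u \<in> g) \<in> g"
    using assms(2) by (rule someI)
  then have "as_eq Q (SOME u. u \<in> g) u"
    using w assms(2) by (blast intro: as_eq.trans as_eq.sym)
  then show ?thesis
    unfolding ext_colour_def using x by (intro ext_act_as_eq [OF \<phi>] as_eq_map [OF c]) auto
qed

text \<open>If \<open>g\<close> and \<open>h\<close> label the regions on the two sides of an arc \<open>q\<close>, this is how the extended colour
  changes across the arc.\<close>

lemma ext_colour_mult:
  assumes "g \<in> carrier (As Q)" "h \<in> carrier (As Q)" "q \<in> carrier Q" "h = g \<otimes>\<^bsub>As Q\<^esub> as_gen Q q"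
  shows "ext_colour X \<phi> x c h = ext_step X \<phi> (ext_colour X \<phi> x c g) (c q, True)"
proof -
  obtain u where u: "u \<in> qwords Q" "u \<in> g"
    using assms(1) by (auto elim: As_carrierE)
  have "[(q, True)] \<in> as_gen Q q" "as_eq Q (u @ [(q, True)]) (u @ [(q, True)])"
    using assms(3) u by (auto simp: as_gen_def qwords_def intro!: as_eq.refl)
  then have "u @ [(q, True)] \<in> h"
    using u assms(4) by (auto simp: As_def)
  then show ?thesis
    using ext_colour_eq assms(1,2) u by simp
qed

lemma quandle_act_as_map:
  assumes "g \<in> carrier (As Q)"
  shows "quandle_act X x (as_map X c g) = fst (ext_colour X \<phi> x c g)"
proof -
  obtain u where u: "u \<in> qwords Q" "u \<in> g" "\<And>v. v \<in> g \<longleftrightarrow> as_eq Q u v"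
    using assms by (auto elim: As_carrierE)
  have w: "w \<in> as_map X c g \<longleftrightarrow> as_eq X (map (apfst c) u) w" for w
    using u as_eq_map [OF c] unfolding as_map_def by (blast intro: as_eq.trans)
  have "word_act X x w = word_act X x (map (apfst c) u)" if "w \<in> as_map X c g" for w
    using that w ext_act_as_eq [OF \<phi>, of _ _ "(x, 0)"] x fst_ext_act [of X \<phi> "(x, 0)"]
    by (metis fst_conv)
  moreover have "map (apfst c) u \<in> as_map X c g"
    using w as_eq_map [OF c] u by blast
  ultimately have "quandle_act X x (as_map X c g) = word_act X x (map (apfst c) u)"
    unfolding quandle_act_def by (rule_tac the_equality) blast+
  then show ?thesis
    using ext_colour_eq [OF assms u(2)] by (simp add: fst_ext_act)
qed

end

end

lemma qgen_in_carrier: "a \<in> S \<Longrightarrow> qgen S R a \<in> carrier (qpres S R)"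
  using quotientI [of "QGen a" "qterms S" "{(s, t). qterm_eq S R s t}"]
  by (simp add: qpres_def qgen_def qterms_def Image_def)


section \<open>Jumps of piecewise constant functions\<close>

text \<open>One-sided limits are taken to be values that are eventually attained, as fits piecewise constant
  functions into a group without topology.\<close>

definition jump :: "(real \<Rightarrow> 'a::ab_group_add) \<Rightarrow> real \<Rightarrow> 'a" where
  "jump f t = (THE c. \<exists>p m. (\<forall>\<^sub>F s in at_right t. f s = p) \<and> (\<forall>\<^sub>F s in at_left t. f s = m) \<and> c = p - m)"

lemma eventually_eq_const_unique:
  assumes "F \<noteq> bot" "\<forall>\<^sub>F s in F. f s = a" "\<forall>\<^sub>F s in F. f s = b"
  shows "a = b"
proof -
  have "\<forall>\<^sub>F s in F. a = b"
    using assms(2,3) by eventually_elim simp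
  with assms(1) show ?thesis
    by (simp add: eventually_const)
qed

lemma jump_eq:
  assumes "\<forall>\<^sub>F s in at_right t. f s = p" "\<forall>\<^sub>F s in at_left t. f s = m"
  shows "jump f t = p - m"
  unfolding jump_def
proof (rule the_equality)
  show "\<exists>p' m'. (\<forall>\<^sub>F s in at_right t. f s = p') \<and> (\<forall>\<^sub>F s in at_left t. f s = m') \<and> p - m = p' - m'"
    using assms by blast
next
  fix c assume "\<exists>p m. (\<forall>\<^sub>F s in at_right t. f s = p) \<and> (\<forall>\<^sub>F s in at_left t. f s = m) \<and> c = p - m"
  then obtain p' m' where *: "\<forall>\<^sub>F s in at_right t. f s = p'" "\<forall>\<^sub>F s in at_left t. f s = m'" "c = p' - m'"
    by blast
  have "p' = p"
    by (rule eventually_eq_const_unique [OF trivial_limit_at_right_real *(1) assms(1)])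
  moreover have "m' = m"
    by (rule eventually_eq_const_unique [OF trivial_limit_at_left_real *(2) assms(2)])
  ultimately
  show "c = p - m"
    using *(3) by simp
qed

text \<open>The telescoping sum along an interval, obtained without sorting the jump points: after subtraction
  of the jumps that lie before \<open>t\<close>, the function is locally constant on a connected set.\<close>

lemma sum_jumps:
  fixes f :: "real \<Rightarrow> 'a::ab_group_add"
  assumes S: "finite S" "S \<subseteq> {0<..<1}"
    and loc: "\<And>t. t \<in> {0<..<1} - S \<Longrightarrow> \<forall>\<^sub>F s in at t. f s = f t"
    and lim: "\<And>t. t \<in> S \<Longrightarrow> \<exists>p m. (\<forall>\<^sub>F s in at_right t. f s = p) \<and> (\<forall>\<^sub>F s in at_left t. f s = m)"
    and start: "\<forall>\<^sub>F s in at_right 0. f s = f0" and finish: "\<forall>\<^sub>F s in at_left 1. f s = f1"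
  shows "(\<Sum>t\<in>S. jump f t) = f1 - f0"
proof -
  obtain p m where p: "\<And>t. t \<in> S \<Longrightarrow> \<forall>\<^sub>F s in at_right t. f s = p t"
    and m: "\<And>t. t \<in> S \<Longrightarrow> \<forall>\<^sub>F s in at_left t. f s = m t"
    using lim by metis
  have jump: "jump f t = p t - m t" if "t \<in> S" for t
    using jump_eq p m that by blast
  \<comment> \<open>Subtracting the jumps passed so far leaves a function without jumps.\<close>
  define G where "G t = (if t \<in> S then m t else f t) - (\<Sum>s\<in>{s \<in> S. s < t}. jump f s)" for t
  have gap: "\<exists>d>0. \<forall>s. \<bar>s - t\<bar> < d \<and> s \<noteq> t \<longrightarrow> s \<notin> S" for t
    using finite_set_avoid [OF S(1), of t] by (fastforce simp: dist_real_def abs_minus_commute)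
  have left: "\<forall>\<^sub>F s in at_left t. s \<notin> S \<and> {s' \<in> S. s' < s} = {s' \<in> S. s' < t}" for t
  proof -
    obtain d where d: "d > 0" "\<And>s. \<bar>s - t\<bar> < d \<Longrightarrow> s \<noteq> t \<Longrightarrow> s \<notin> S"
      using gap by blast
    have "y \<notin> S \<and> {s' \<in> S. s' < y} = {s' \<in> S. s' < t}" if "t - d < y" "y < t" for y
    proof -
      have "s' \<le> t - d" if "s' \<in> S" "s' < t" for s'
        using d(2) [of s'] that by linarith
      with that d(2) [of y] show ?thesis
        by fastforce
    qed
    then show ?thesis
      unfolding eventually_at_left_field using d(1) by (intro exI [of _ "t - d"]) simp
  qed
  have right: "\<forall>\<^sub>F s in at_right t. s \<notin> S \<and> {s' \<in> S. s' < s} = {s' \<in> S. s' \<le> t}" for t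
  proof -
    obtain d where d: "d > 0" "\<And>s. \<bar>s - t\<bar> < d \<Longrightarrow> s \<noteq> t \<Longrightarrow> s \<notin> S"
      using gap by blast
    have "y \<notin> S \<and> {s' \<in> S. s' < y} = {s' \<in> S. s' \<le> t}" if "t < y" "y < t + d" for y
    proof -
      have "s' \<ge> t + d" if "s' \<in> S" "s' > t" for s'
        using d(2) [of s'] that by linarith
      with that d(2) [of y] show ?thesis
        by fastforce
    qed
    then show ?thesis
      unfolding eventually_at_right_field using d(1) by (intro exI [of _ "t + d"]) simp
  qed
  have G: "\<forall>\<^sub>F s in at t. G t = G s" if t: "t \<in> {0<..<1}" for t
    unfolding eventually_at_split
  proof
    have "\<forall>\<^sub>F s in at_left t. f s = (if t \<in> S then m t else f t)"
      using m loc [of t] t by (auto simp: eventually_at_split)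
    with left [of t] show "\<forall>\<^sub>F s in at_left t. G t = G s"
      by eventually_elim (simp add: G_def)
    have *: "{s \<in> S. s \<le> t} = (if t \<in> S then insert t {s \<in> S. s < t} else {s \<in> S. s < t})"
      by (auto simp: less_le)
    have "\<forall>\<^sub>F s in at_right t. f s = (if t \<in> S then p t else f t)"
      using p loc [of t] t by (auto simp: eventually_at_split)
    with right [of t] show "\<forall>\<^sub>F s in at_right t. G t = G s"
      by eventually_elim (use S(1) in \<open>auto simp: G_def * jump\<close>)
  qed
  have "\<forall>\<^sub>F s in at_right (0::real). s < 1" "\<forall>\<^sub>F s in at_left (1::real). s > 0"
    by (auto simp: eventually_at_right_field eventually_at_left_field intro: exI [of _ 1] exI [of _ 0])
  then have "\<forall>\<^sub>F s in at_right 0. s \<in> {0<..<1} \<and> G s = f0" "\<forall>\<^sub>F s in at_left 1. s \<in> {0<..<1} \<and> G s = f1 - (\<Sum>t\<in>S. jump f t)"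
  proof -
    assume *: "\<forall>\<^sub>F s in at_right (0::real). s < 1" "\<forall>\<^sub>F s in at_left (1::real). s > 0"
    have empty: "{s \<in> S. s \<le> 0} = {}" and all: "{s \<in> S. s < 1} = S"
      using S by auto
    have "\<forall>\<^sub>F s in at_right (0::real). s > 0" "\<forall>\<^sub>F s in at_left (1::real). s < 1"
      by (auto simp: eventually_at_filter)
    note * = * this
    show "\<forall>\<^sub>F s in at_right 0. s \<in> {0<..<1} \<and> G s = f0"
      using right [of 0] start *(1,3) by eventually_elim (simp only: G_def empty, simp)
    show "\<forall>\<^sub>F s in at_left 1. s \<in> {0<..<1} \<and> G s = f1 - (\<Sum>t\<in>S. jump f t)"
      using left [of 1] finish *(2,4) by eventually_elim (simp only: G_def all, simp)
  qed
  note ends = this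
  obtain a where a: "a \<in> {0<..<1}" "G a = f0"
    using eventually_happens' [OF trivial_limit_at_right_real ends(1)] by blast
  obtain b where b: "b \<in> {0<..<1}" "G b = f1 - (\<Sum>t\<in>S. jump f t)"
    using eventually_happens' [OF trivial_limit_at_left_real ends(2)] by blast
  have "G a = G b"
    using G a(1) b(1)
    by (intro connected_local_const [where A = "{0<..<1::real}"])
       (auto simp: at_within_open [OF _ open_greaterThanLessThan])
  then show ?thesis
    using a b by (simp add: algebra_simps)
qed


section \<open>Plane geometry of a regular diagram\<close>

text \<open>An edge is parametrized affinely by \<open>{0..1}\<close>: \<open>lift D e t\<close> is its point in space at time \<open>t\<close>, and
  \<open>pt D e t\<close> is the projection of this point. Other real times describe the line through the edge.\<close>

definition lift :: "polylink \<Rightarrow> edge \<Rightarrow> real \<Rightarrow> real^3" where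
  "lift D e t = source D e + t *\<^sub>R direction D e"

definition pt :: "polylink \<Rightarrow> edge \<Rightarrow> real \<Rightarrow> complex" where
  "pt D e t = proj (lift D e t)"

definition vec_of :: "polylink \<Rightarrow> edge \<Rightarrow> complex" where
  "vec_of D e = proj (direction D e)"

text \<open>The determinant of two projected edge vectors: it vanishes iff they are parallel, and its sign is
  the sign of a crossing with \<open>e\<close> above \<open>f\<close>.\<close>

definition cross :: "polylink \<Rightarrow> edge \<Rightarrow> edge \<Rightarrow> real" where
  "cross D e f = Im (cnj (vec_of D e) * vec_of D f)"

text \<open>Positive on the left of the line through an edge, negative on its right.\<close>

definition side :: "polylink \<Rightarrow> edge \<Rightarrow> complex \<Rightarrow> real" where
  "side D e w = Im (cnj (vec_of D e) * (w - pt D e 0))"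

lemma proj_linear: "linear proj"
  by (rule linearI) (auto simp: proj_def complex_eq_iff)

lemma proj_height_eqD: "\<lbrakk>proj p = proj q; height p = height q\<rbrakk> \<Longrightarrow> p = q"
  by (auto simp: proj_def height_def vec_eq_iff forall_3)

lemma pt_eq: "pt D e t = pt D e 0 + t *\<^sub>R vec_of D e"
  by (simp add: pt_def lift_def vec_of_def linear_add [OF proj_linear] linear_scale [OF proj_linear])

lemma pt_add: "pt D e (t + s) = pt D e t + s *\<^sub>R vec_of D e"
  by (subst (1 2) pt_eq) (simp add: algebra_simps)

lemma edge_points_eq: "edge_points D e = lift D e ` {0..1}"
  unfolding edge_points_def closed_segment_def lift_def direction_def image_def
  by (auto simp: algebra_simps)

lemma open_edge_eq: "t \<in> {0<..<1} \<Longrightarrow> source D e \<noteq> target D e \<Longrightarrow> lift D e t \<in> open_segment (source D e) (target D e)"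
  unfolding in_segment lift_def direction_def
  by (auto simp: algebra_simps)

lemma proj_edge_points: "proj ` edge_points D e = pt D e ` {0..1}"
  by (simp add: edge_points_eq pt_def image_image)

lemma proj_link_points: "proj ` link_points D = (\<Union>e\<in>edges D. pt D e ` {0..1})"
  by (simp add: link_points_def image_UN proj_edge_points)

lemma continuous_lift [continuous_intros]: "continuous_on A (lift D e)"
  unfolding lift_def by (intro continuous_intros)

lemma continuous_pt [continuous_intros]: "continuous_on A (pt D e)"
  by (subst pt_eq [abs_def]) (intro continuous_intros)

lemma tendsto_pt: "(pt D e \<longlongrightarrow> pt D e t) (at t within A)"
  using continuous_pt [of UNIV] by (metis UNIV_I continuous_on_def tendsto_within_subset top_greatest)

lemma continuous_side [continuous_intros]: "continuous_on A (side D e)"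
  unfolding side_def by (intro continuous_intros)

lemma side_diff: "side D e w = side D e z + Im (cnj (vec_of D e) * (w - z))"
  by (simp add: side_def algebra_simps)

lemma side_pt [simp]: "side D e (pt D e t) = 0"
  by (subst pt_eq) (simp add: side_def algebra_simps)

lemma side_pt_add: "side D e (pt D f (t + s)) = side D e (pt D f t) + s * cross D e f"
  by (subst side_diff [of _ _ _ "pt D f t"]) (simp only: pt_add cross_def, simp add: algebra_simps)

lemma cross_commute: "cross D f e = - cross D e f"
  by (simp add: cross_def algebra_simps)

lemma finite_edges: "finite (edges D)"
  by (rule finite_subset [of _ "\<Union>i<length D. {i} \<times> {..<length (D ! i)}"]) (auto simp: edges_def)

lemma finite_crossings: "finite (crossings D)"
  by (rule finite_subset [OF _ finite_cartesian_product [OF finite_edges finite_edges]])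
     (auto simp: crossings_def)

lemma pt_next_edge: "pt D (next_edge D e) 0 = pt D e 1" "lift D (next_edge D e) 0 = lift D e 1"
  by (simp_all add: pt_def lift_def direction_def target_def)

lemma lines_meet_once:
  assumes "cross D e f \<noteq> 0" "pt D e t = pt D f u" "pt D e t' = pt D f u'"
  shows "t' = t \<and> u' = u"
proof -
  have "pt D e t' = pt D e t + (t' - t) *\<^sub>R vec_of D e" "pt D f u' = pt D f u + (u' - u) *\<^sub>R vec_of D f"
    using pt_add [of D e t "t' - t"] pt_add [of D f u "u' - u"] by simp_all
  then have *: "(t' - t) *\<^sub>R vec_of D e = (u' - u) *\<^sub>R vec_of D f"
    using assms by simp
  have "(t' - t) * cross D e f = Im (cnj ((t' - t) *\<^sub>R vec_of D e) * vec_of D f)"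
    by (simp add: cross_def algebra_simps)
  also have "\<dots> = 0"
    unfolding * by simp
  finally have "t' = t"
    using assms(1) by simp
  moreover have "(u' - u) * cross D e f = Im (cnj (vec_of D e) * ((u' - u) *\<^sub>R vec_of D f))"
    by (simp add: cross_def algebra_simps)
  then have "(u' - u) * cross D e f = 0"
    by (simp flip: *)
  ultimately show ?thesis
    using assms(1) by simp
qed

locale regular_link_diagram =
  fixes D :: polylink
  assumes regular: "regular_diagram D"
begin

lemma length_component: "(i, j) \<in> edges D \<Longrightarrow> 3 \<le> length (D ! i) \<and> j < length (D ! i)"
  using regular by (auto simp: regular_diagram_def edges_def)

lemma next_edge_in_edges: "e \<in> edges D \<Longrightarrow> next_edge D e \<in> edges D"
proof -
  assume e: "e \<in> edges D"
  obtain i j where ij: "e = (i, j)"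
    by (meson surj_pair)
  have "Suc j mod length (D ! i) < length (D ! i)"
    using length_component [of i j] e ij by (intro mod_less_divisor) auto
  with e ij show ?thesis
    by (simp add: edges_def)
qed

lemma next_edge_inj: "inj_on (next_edge D) (edges D)"
proof (rule inj_onI)
  fix e f assume ef: "e \<in> edges D" "f \<in> edges D" "next_edge D e = next_edge D f"
  obtain i j i' j' where "e = (i, j)" "f = (i', j')"
    by (meson surj_pair)
  with ef show "e = f"
    by (auto simp: edges_def mod_Suc split: if_splits)
qed

lemma next_edge_image: "next_edge D ` edges D = edges D"
  using endo_inj_surj [OF finite_edges _ next_edge_inj] next_edge_in_edges by blast

lemma next_edge_neq:
  assumes "e \<in> edges D"
  shows "next_edge D e \<noteq> e" "next_edge D (next_edge D e) \<noteq> e"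
  using assms length_component by (cases e; fastforce simp: mod_Suc split: if_splits)+

lemma vec_of_nonzero: "e \<in> edges D \<Longrightarrow> vec_of D e \<noteq> 0"
  using regular unfolding regular_diagram_def vec_of_def direction_def linear_diff [OF proj_linear]
  by (metis eq_iff_diff_eq_0)

lemma pt_inj: "e \<in> edges D \<Longrightarrow> pt D e t = pt D e s \<longleftrightarrow> t = s"
  using vec_of_nonzero [of e] by (subst (1 2) pt_eq) simp

lemma vertex_at_end:
  assumes "e \<in> edges D" "f \<in> edges D" "pt D e 1 = pt D f t" "t \<in> {0..1}"
  shows "f = e \<or> f = next_edge D e"
proof -
  have "proj (target D e) = pt D e 1"
    by (simp add: pt_def lift_def direction_def)
  then have "proj (target D e) \<in> proj ` edge_points D f"
    unfolding proj_edge_points using assms(3,4) by (intro image_eqI [of _ _ t]) simp_all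
  moreover have "\<forall>e\<in>edges D. \<forall>f\<in>edges D.
      proj (target D e) \<in> proj ` edge_points D f \<longrightarrow> f = e \<or> f = next_edge D e"
    using regular unfolding regular_diagram_def by (elim conjE)
  ultimately show ?thesis
    using assms(1,2) by simp
qed

lemma vertex_at_start:
  assumes "e \<in> edges D" "f \<in> edges D" "pt D e 0 = pt D f t" "t \<in> {0..1}"
  shows "f = e \<or> e = next_edge D f"
proof -
  obtain g where g: "g \<in> edges D" "e = next_edge D g"
    using assms(1) next_edge_image by blast
  then have "f = g \<or> f = next_edge D g"
    using assms vertex_at_end [of g f t] by (simp add: pt_next_edge)
  with g show ?thesis
    by blast
qed

lemma double_point_interior:
  assumes "e \<in> edges D" "f \<in> edges D" "e \<noteq> f" "t \<in> {0<..<1}" "u \<in> {0..1}" "pt D e t = pt D f u"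
  shows "u \<in> {0<..<1}"
proof (rule ccontr)
  assume "u \<notin> {0<..<1}"
  then consider "u = 0" | "u = 1"
    using assms(5) by force
  then show False
  proof cases
    case 1
    then have "f = next_edge D e"
      using vertex_at_start [of f e t] assms by auto
    then have "t = 1"
      using 1 assms pt_next_edge by (metis pt_inj)
    then show False using assms by simp
  next
    case 2
    then have "e = next_edge D f"
      using vertex_at_end [of f e t] assms by auto
    then have "t = 0"
      using 2 assms pt_next_edge by (metis pt_inj)
    then show False using assms by simp
  qed
qed

text \<open>Project \<open>vec_of D f\<close> orthogonally onto \<open>vec_of D e\<close>; nothing is lost if the determinant vanishes.\<close>

lemma parallel_edges:
  assumes "e \<in> edges D" "f \<in> edges D" "cross D e f = 0"
  obtains k where "k \<noteq> 0" "vec_of D f = k *\<^sub>R vec_of D e"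
proof
  let ?v = "vec_of D e" and ?w = "vec_of D f"
  let ?k = "Re (cnj ?v * ?w) / (cmod ?v)\<^sup>2"
  have v: "?v \<noteq> 0" "?w \<noteq> 0"
    using vec_of_nonzero assms by auto
  have "cnj ?v * ?w = of_real (Re (cnj ?v * ?w))"
    using assms(3) by (simp add: cross_def complex_eq_iff)
  then have "?v * (cnj ?v * ?w) = ?v * of_real (Re (cnj ?v * ?w))"
    by simp
  then have "of_real ((cmod ?v)\<^sup>2) * ?w = ?v * of_real (Re (cnj ?v * ?w))"
    by (simp only: complex_norm_square mult.assoc flip: of_real_power)
  then show *: "?w = ?k *\<^sub>R ?v"
    using v by (simp add: scaleR_conv_of_real field_simps)
  show "?k \<noteq> 0"
    using * v by force
qed

text \<open>If two edges overlapped, then on either side of the common point an endpoint of one of them would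
  lie on the other one, so the edges would be consecutive. But consecutive edges with the same
  direction share nothing but their vertex. If the directions are opposite, the two sides show that
  each of the edges follows the other one, and a component would consist of two edges.\<close>

lemma double_point_transverse:
  assumes ef: "e \<in> edges D" "f \<in> edges D" "e \<noteq> f"
    and tu: "t \<in> {0<..<1}" "u \<in> {0<..<1}" "pt D e t = pt D f u"
  shows "cross D e f \<noteq> 0"
proof
  assume "cross D e f = 0"
  then obtain k where k: "k \<noteq> 0" "vec_of D f = k *\<^sub>R vec_of D e"
    using parallel_edges ef by blast
  have f: "pt D f y = pt D e (t + (y - u) * k)" for y
    using pt_add [of D f u "y - u"] pt_add [of D e t "(y - u) * k"] tu k by simp
  have e: "pt D e x = pt D f (u + (x - t) / k)" for x
    using f [of "u + (x - t) / k"] k by simp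
  have next_f: "f = next_edge D e" if "pt D e 1 = pt D f y" "y \<in> {0..1}" for y
    using vertex_at_end [of e f y] that ef by blast
  have next_e: "e = next_edge D f" if "pt D f 1 = pt D e x" "x \<in> {0..1}" for x
    using vertex_at_end [of f e x] that ef by blast
  have next_f': "f = next_edge D e" if "pt D f 0 = pt D e x" "x \<in> {0..1}" for x
    using vertex_at_start [of f e x] that ef by blast
  have next_e': "e = next_edge D f" if "pt D e 0 = pt D f y" "y \<in> {0..1}" for y
    using vertex_at_start [of e f y] that ef by blast
  show False
  proof (cases "k > 0")
    case True
    have "f = next_edge D e \<or> e = next_edge D f"
    proof (cases "1 - t \<le> (1 - u) * k")
      case le: True
      then have "(1 - t) / k \<le> 1 - u" "0 \<le> (1 - t) / k"
        using True tu by (auto simp: field_simps)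
      then show ?thesis
        using tu by (intro disjI1 next_f [OF e]) auto
    next
      case False
      then show ?thesis
        using tu True by (intro disjI2 next_e [OF f]) (auto simp: add_nonneg_nonneg)
    qed
    then show False
    proof
      assume "f = next_edge D e"
      then have "t + (0 - u) * k = 1"
        using f [of 0] pt_next_edge(1) [of D e] pt_inj [of e] ef by metis
      moreover have "u * k > 0"
        using True tu by simp
      ultimately show False using tu by simp
    next
      assume "e = next_edge D f"
      then have "t + (1 - u) * k = 0"
        using f [of 1] pt_next_edge(1) [of D f] pt_inj [of e] ef by metis
      moreover have "(1 - u) * k > 0"
        using True tu by simp
      ultimately show False using tu by simp
    qed
  next
    case False
    then have neg: "k < 0" using k by simp
    have "f = next_edge D e"
    proof (cases "1 - t \<le> - u * k")
      case le: True
      then have "- u \<le> (1 - t) / k" "(1 - t) / k \<le> 0"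
        using neg tu by (auto simp: field_simps)
      then show ?thesis
        using tu by (intro next_f [OF e]) auto
    next
      case gt: False
      have "u * k \<le> 0" using neg tu by (simp add: mult_nonneg_nonpos)
      then show ?thesis
        using tu gt by (intro next_f' [OF f]) auto
    qed
    moreover have "e = next_edge D f"
    proof (cases "t \<le> - (1 - u) * k")
      case le: True
      then have "- t / k \<le> 1 - u" "0 \<le> - t / k"
        using neg tu by (auto simp: field_simps)
      then show ?thesis
        using tu by (intro next_e' [OF e]) auto
    next
      case gt: False
      have "(1 - u) * k \<le> 0" using neg tu by (simp add: mult_nonneg_nonpos)
      then show ?thesis
        using tu gt by (intro next_e [OF f]) (auto simp: algebra_simps)
    qed
    ultimately show False
      using next_edge_neq ef by metis
  qed
qed

lemma double_point_heights:
  assumes ef: "e \<in> edges D" "f \<in> edges D" "e \<noteq> f"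
    and tu: "t \<in> {0<..<1}" "u \<in> {0<..<1}" "pt D e t = pt D f u"
  shows "height (lift D e t) \<noteq> height (lift D f u)"
proof
  assume "height (lift D e t) = height (lift D f u)"
  then have eq: "lift D e t = lift D f u"
    using tu(3) by (intro proj_height_eqD) (simp_all add: pt_def)
  have "lift D e t \<in> edge_points D e" "lift D f u \<in> edge_points D f"
    using tu by (auto simp: edge_points_eq)
  then have "edge_points D e \<inter> edge_points D f \<noteq> {}"
    using eq by auto
  moreover have "\<forall>e\<in>edges D. \<forall>f\<in>edges D. edge_points D e \<inter> edge_points D f \<noteq> {} \<longrightarrow>
      f = e \<or> f = next_edge D e \<or> e = next_edge D f"
    using regular unfolding regular_diagram_def by (elim conjE)
  ultimately have "f = next_edge D e \<or> e = next_edge D f"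
    using ef by auto
  then have "pt D e 1 = pt D f 0 \<or> pt D e 0 = pt D f 1"
    by (auto simp: pt_next_edge)
  then show False
    using lines_meet_once [OF double_point_transverse [OF ef tu] tu(3), of 1 0]
      lines_meet_once [OF double_point_transverse [OF ef tu] tu(3), of 0 1] tu by auto
qed

lemma no_triple_points:
  assumes "e \<in> edges D" "f \<in> edges D" "g \<in> edges D" "e \<noteq> f" "f \<noteq> g" "e \<noteq> g"
    and "q \<in> pt D e ` {0..1}" "q \<in> pt D f ` {0..1}" "q \<in> pt D g ` {0..1}"
  shows False
proof -
  have "\<forall>e\<in>edges D. \<forall>f\<in>edges D. \<forall>g\<in>edges D. e \<noteq> f \<and> f \<noteq> g \<and> e \<noteq> g \<longrightarrow>
      pt D e ` {0..1} \<inter> pt D f ` {0..1} \<inter> pt D g ` {0..1} = {}"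
    using regular unfolding regular_diagram_def proj_edge_points by (elim conjE)
  then have "pt D e ` {0..1} \<inter> pt D f ` {0..1} \<inter> pt D g ` {0..1} = {}"
    using assms(1-6) by simp
  then show False
    using assms(7-9) by blast
qed

end


section \<open>Crossings\<close>

text \<open>The times at which the two edges of a crossing pass it. They are determined by the projected lines
  alone, since these are not parallel.\<close>

definition over_time :: "polylink \<Rightarrow> crossing \<Rightarrow> real" where
  "over_time D \<tau> = (THE t. \<exists>u. pt D (fst \<tau>) t = pt D (snd \<tau>) u)"

definition under_time :: "polylink \<Rightarrow> crossing \<Rightarrow> real" where
  "under_time D \<tau> = (THE u. \<exists>t. pt D (fst \<tau>) t = pt D (snd \<tau>) u)"

definition crossing_pt :: "polylink \<Rightarrow> crossing \<Rightarrow> complex" where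
  "crossing_pt D \<tau> = pt D (fst \<tau>) (over_time D \<tau>)"

definition double_times :: "polylink \<Rightarrow> edge \<Rightarrow> real set" where
  "double_times D e = {t \<in> {0<..<1}. \<exists>f\<in>edges D - {e}. pt D e t \<in> pt D f ` {0..1}}"

lemma crossing_times_eq:
  assumes "cross D (fst \<tau>) (snd \<tau>) \<noteq> 0" "pt D (fst \<tau>) t = pt D (snd \<tau>) u"
  shows "over_time D \<tau> = t" "under_time D \<tau> = u"
proof -
  have *: "t' = t \<and> u' = u" if "pt D (fst \<tau>) t' = pt D (snd \<tau>) u'" for t' u'
    by (rule lines_meet_once [OF assms that])
  show "over_time D \<tau> = t" "under_time D \<tau> = u"
    unfolding over_time_def under_time_def using assms(2) * by (blast intro!: the_equality)+
qed

context regular_link_diagram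
begin

text \<open>At a common vertex two consecutive edges have the same height, so a crossing lies in the interior of
  both of its edges.\<close>

lemma crossing_times_exist:
  assumes "\<tau> \<in> crossings D"
  shows "fst \<tau> \<in> edges D \<and> snd \<tau> \<in> edges D \<and> fst \<tau> \<noteq> snd \<tau> \<and>
    (\<exists>t\<in>{0<..<1}. \<exists>u\<in>{0<..<1}. pt D (fst \<tau>) t = pt D (snd \<tau>) u \<and>
       height (lift D (snd \<tau>) u) < height (lift D (fst \<tau>) t))"
proof -
  obtain e f where \<tau>: "\<tau> = (e, f)"
    by (rule prod.exhaust)
  obtain t u where tu: "t \<in> {0..1}" "u \<in> {0..1}" "pt D e t = pt D f u" "height (lift D f u) < height (lift D e t)"
    and ef: "e \<in> edges D" "f \<in> edges D"
    using assms by (auto simp: \<tau> crossings_def edge_points_eq pt_def)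
  have "e \<noteq> f"
    using tu pt_inj [OF ef(1)] by auto
  have "t \<noteq> 1"
  proof
    assume "t = 1"
    then have eq: "pt D e 1 = pt D f u"
      using tu(3) by simp
    then have f: "f = next_edge D e"
      using vertex_at_end [OF ef eq tu(2)] \<open>e \<noteq> f\<close> by blast
    have "pt D f 0 = pt D f u"
      by (rule HOL.trans [OF _ eq]) (simp only: f pt_next_edge)
    then have "u = 0"
      using pt_inj [OF ef(2), of 0 u] by simp
    then have "lift D f u = lift D e t"
      unfolding f \<open>t = 1\<close> by (simp add: pt_next_edge)
    then show False
      using tu(4) by simp
  qed
  have "t \<noteq> 0"
  proof
    assume "t = 0"
    then have eq: "pt D e 0 = pt D f u"
      using tu(3) by simp
    then have e: "e = next_edge D f"
      using vertex_at_start [OF ef eq tu(2)] \<open>e \<noteq> f\<close> by blast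
    have "pt D f u = pt D f 1"
      unfolding eq [symmetric] e by (rule pt_next_edge)
    then have "u = 1"
      using pt_inj [OF ef(2), of u 1] by simp
    then have "lift D e t = lift D f u"
      unfolding e \<open>t = 0\<close> by (simp add: pt_next_edge)
    then show False
      using tu(4) by simp
  qed
  have t: "t \<in> {0<..<1}"
    using tu \<open>t \<noteq> 0\<close> \<open>t \<noteq> 1\<close> by auto
  then have "u \<in> {0<..<1}"
    using double_point_interior [of e f t u] ef tu \<open>e \<noteq> f\<close> by blast
  with t ef \<open>e \<noteq> f\<close> tu(3,4) show ?thesis
    unfolding \<tau> fst_conv snd_conv by blast
qed

lemma
  assumes "\<tau> \<in> crossings D"
  shows crossing_edges: "fst \<tau> \<in> edges D" "snd \<tau> \<in> edges D" "fst \<tau> \<noteq> snd \<tau>"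
    and crossing_transverse: "cross D (fst \<tau>) (snd \<tau>) \<noteq> 0"
    and crossing_times: "over_time D \<tau> \<in> {0<..<1}" "under_time D \<tau> \<in> {0<..<1}"
    and crossing_pt_under: "pt D (snd \<tau>) (under_time D \<tau>) = crossing_pt D \<tau>"
    and crossing_heights: "height (lift D (snd \<tau>) (under_time D \<tau>)) < height (lift D (fst \<tau>) (over_time D \<tau>))"
proof -
  show ef: "fst \<tau> \<in> edges D" "snd \<tau> \<in> edges D" "fst \<tau> \<noteq> snd \<tau>"
    using crossing_times_exist [OF assms] by auto
  obtain t u where tu: "t \<in> {0<..<1}" "u \<in> {0<..<1}" "pt D (fst \<tau>) t = pt D (snd \<tau>) u"
      "height (lift D (snd \<tau>) u) < height (lift D (fst \<tau>) t)"
    using crossing_times_exist [OF assms] by auto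
  show c: "cross D (fst \<tau>) (snd \<tau>) \<noteq> 0"
    by (rule double_point_transverse [OF ef tu(1,2,3)])
  note [simp] = crossing_times_eq [OF c tu(3)]
  show "over_time D \<tau> \<in> {0<..<1}" "under_time D \<tau> \<in> {0<..<1}"
      "pt D (snd \<tau>) (under_time D \<tau>) = crossing_pt D \<tau>"
      "height (lift D (snd \<tau>) (under_time D \<tau>)) < height (lift D (fst \<tau>) (over_time D \<tau>))"
    using tu by (auto simp: crossing_pt_def)
qed

lemma crossing_pt_on_edges:
  assumes "\<tau> \<in> crossings D"
  shows "crossing_pt D \<tau> \<in> pt D (fst \<tau>) ` {0..1}" "crossing_pt D \<tau> \<in> pt D (snd \<tau>) ` {0..1}"
proof -
  show "crossing_pt D \<tau> \<in> pt D (fst \<tau>) ` {0..1}"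
    unfolding crossing_pt_def using crossing_times [OF assms] by (intro imageI) auto
  show "crossing_pt D \<tau> \<in> pt D (snd \<tau>) ` {0..1}"
    unfolding crossing_pt_under [OF assms, symmetric] using crossing_times [OF assms] by (intro imageI) auto
qed

lemma crossing_points:
  assumes "\<tau> \<in> crossings D"
  shows "over_point D \<tau> = lift D (fst \<tau>) (over_time D \<tau>)"
    and "under_point D \<tau> = lift D (snd \<tau>) (under_time D \<tau>)"
proof -
  note meet = crossing_times_eq [OF crossing_transverse [OF assms]]
  have pt: "pt D (fst \<tau>) (over_time D \<tau>) = pt D (snd \<tau>) (under_time D \<tau>)"
    using crossing_pt_under [OF assms] by (simp add: crossing_pt_def)
  have over: "p = lift D (fst \<tau>) (over_time D \<tau>)"
    if p: "p \<in> edge_points D (fst \<tau>)" "proj p \<in> proj ` edge_points D (snd \<tau>)" for p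
  proof -
    obtain t where t: "p = lift D (fst \<tau>) t"
      using p(1) by (auto simp: edge_points_eq)
    moreover obtain u where "pt D (fst \<tau>) t = pt D (snd \<tau>) u"
      using p(2) by (auto simp: proj_edge_points t pt_def)
    ultimately show ?thesis
      using meet by simp
  qed
  have under: "p = lift D (snd \<tau>) (under_time D \<tau>)"
    if p: "p \<in> edge_points D (snd \<tau>)" "proj p \<in> proj ` edge_points D (fst \<tau>)" for p
  proof -
    obtain u where u: "p = lift D (snd \<tau>) u"
      using p(1) by (auto simp: edge_points_eq)
    moreover obtain t where "pt D (snd \<tau>) u = pt D (fst \<tau>) t"
      using p(2) by (auto simp: proj_edge_points u pt_def)
    ultimately show ?thesis
      using meet [of t u] by simp
  qed
  have o: "over_time D \<tau> \<in> {0..1}" and u: "under_time D \<tau> \<in> {0..1}"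
    using crossing_times [OF assms] by auto
  have proj: "proj (lift D (fst \<tau>) (over_time D \<tau>)) = crossing_pt D \<tau>"
    "proj (lift D (snd \<tau>) (under_time D \<tau>)) = crossing_pt D \<tau>"
    using crossing_pt_under [OF assms] by (simp_all add: crossing_pt_def pt_def)
  have "lift D (fst \<tau>) (over_time D \<tau>) \<in> edge_points D (fst \<tau>)"
    "proj (lift D (fst \<tau>) (over_time D \<tau>)) \<in> proj ` edge_points D (snd \<tau>)"
    unfolding proj proj_edge_points using o crossing_pt_on_edges [OF assms] by (simp_all add: edge_points_eq)
  then show "over_point D \<tau> = lift D (fst \<tau>) (over_time D \<tau>)"
    unfolding over_point_def using over by (blast intro!: the_equality)
  have "lift D (snd \<tau>) (under_time D \<tau>) \<in> edge_points D (snd \<tau>)"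
    "proj (lift D (snd \<tau>) (under_time D \<tau>)) \<in> proj ` edge_points D (fst \<tau>)"
    unfolding proj proj_edge_points using u crossing_pt_on_edges [OF assms] by (simp_all add: edge_points_eq)
  then show "under_point D \<tau> = lift D (snd \<tau>) (under_time D \<tau>)"
    unfolding under_point_def using under by (blast intro!: the_equality)
qed

lemma proj_under_point: "\<tau> \<in> crossings D \<Longrightarrow> proj (under_point D \<tau>) = crossing_pt D \<tau>"
  using crossing_pt_under by (simp add: crossing_points flip: pt_def)

lemma edges_through_crossing:
  assumes "\<tau> \<in> crossings D" "g \<in> edges D" "crossing_pt D \<tau> \<in> pt D g ` {0..1}"
  shows "g = fst \<tau> \<or> g = snd \<tau>"
  using no_triple_points [of "fst \<tau>" "snd \<tau>" g "crossing_pt D \<tau>"] crossing_edges [OF assms(1)]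
    crossing_pt_on_edges [OF assms(1)] assms(2,3) by auto

lemma crossing_of_double_point:
  assumes ef: "e \<in> edges D" "f \<in> edges D" "e \<noteq> f"
    and tu: "t \<in> {0<..<1}" "u \<in> {0..1}" "pt D e t = pt D f u"
  shows "(e, f) \<in> crossings D \<and> over_time D (e, f) = t \<or> (f, e) \<in> crossings D \<and> under_time D (f, e) = t"
proof -
  have u: "u \<in> {0<..<1}"
    using double_point_interior assms by blast
  have c: "cross D e f \<noteq> 0" and c': "cross D f e \<noteq> 0"
    using double_point_transverse [OF ef tu(1) u tu(3)] cross_commute [of D f e] by auto
  have mem: "lift D e t \<in> edge_points D e" "lift D f u \<in> edge_points D f"
    and proj: "proj (lift D e t) = proj (lift D f u)"
    using tu by (auto simp: edge_points_eq pt_def)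
  from double_point_heights [OF ef tu(1) u tu(3)]
  consider "height (lift D e t) > height (lift D f u)" | "height (lift D e t) < height (lift D f u)"
    by linarith
  then show ?thesis
  proof cases
    case 1
    then have "(e, f) \<in> crossings D"
      unfolding crossings_def using ef mem proj by blast
    then show ?thesis
      using crossing_times_eq [of D "(e, f)" t u] c tu by simp
  next
    case 2
    then have "(f, e) \<in> crossings D"
      unfolding crossings_def using ef mem proj [symmetric] by blast
    then show ?thesis
      using crossing_times_eq [of D "(f, e)" u t] c' tu by simp
  qed
qed

lemma over_time_double: "\<tau> \<in> crossings D \<Longrightarrow> over_time D \<tau> \<in> double_times D (fst \<tau>)"
  using crossing_times [of \<tau>] crossing_edges [of \<tau>] crossing_pt_under [of \<tau>, symmetric]
  by (auto simp: double_times_def crossing_pt_def intro!: bexI [of _ "snd \<tau>"] imageI)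

lemma under_time_double: "\<tau> \<in> crossings D \<Longrightarrow> under_time D \<tau> \<in> double_times D (snd \<tau>)"
  using crossing_times [of \<tau>] crossing_edges [of \<tau>] crossing_pt_under [of \<tau>]
  by (auto simp: double_times_def crossing_pt_def intro!: bexI [of _ "fst \<tau>"] imageI)

lemma Sigma_double_times:
  "Sigma (edges D) (double_times D) =
     (\<lambda>\<tau>. (fst \<tau>, over_time D \<tau>)) ` crossings D \<union> (\<lambda>\<tau>. (snd \<tau>, under_time D \<tau>)) ` crossings D"
proof (intro equalityI subsetI)
  fix x assume "x \<in> Sigma (edges D) (double_times D)"
  then obtain e t f u where "x = (e, t)" "e \<in> edges D" "f \<in> edges D" "e \<noteq> f" "t \<in> {0<..<1}" "u \<in> {0..1}"
      "pt D e t = pt D f u"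
    unfolding double_times_def by blast
  with crossing_of_double_point [of e f t u]
  show "x \<in> (\<lambda>\<tau>. (fst \<tau>, over_time D \<tau>)) ` crossings D \<union> (\<lambda>\<tau>. (snd \<tau>, under_time D \<tau>)) ` crossings D"
    by (auto intro: rev_image_eqI)
next
  fix x
  assume "x \<in> (\<lambda>\<tau>. (fst \<tau>, over_time D \<tau>)) ` crossings D \<union> (\<lambda>\<tau>. (snd \<tau>, under_time D \<tau>)) ` crossings D"
  then show "x \<in> Sigma (edges D) (double_times D)"
    using crossing_edges over_time_double under_time_double by blast
qed

lemma finite_double_times: "e \<in> edges D \<Longrightarrow> finite (double_times D e)"
proof -
  assume e: "e \<in> edges D"
  have "finite (Sigma (edges D) (double_times D))"
    by (simp add: Sigma_double_times finite_crossings)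
  then have "finite (snd ` Sigma (edges D) (double_times D))"
    by blast
  moreover have "double_times D e \<subseteq> snd ` Sigma (edges D) (double_times D)"
    using e by force
  ultimately show ?thesis
    by (rule rev_finite_subset)
qed

lemma crossing_unique:
  assumes \<tau>: "\<tau> \<in> crossings D" and \<tau>': "\<tau>' \<in> crossings D" and eq: "crossing_pt D \<tau> = crossing_pt D \<tau>'"
  shows "\<tau> = \<tau>'"
proof -
  have "fst \<tau>' = fst \<tau> \<or> fst \<tau>' = snd \<tau>" "snd \<tau>' = fst \<tau> \<or> snd \<tau>' = snd \<tau>"
    using edges_through_crossing [OF \<tau>] crossing_edges [OF \<tau>'] crossing_pt_on_edges [OF \<tau>'] eq by auto
  then consider "\<tau> = \<tau>'" | "fst \<tau>' = snd \<tau>" "snd \<tau>' = fst \<tau>"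
    using crossing_edges [OF \<tau>'] by (auto simp: prod_eq_iff)
  then show ?thesis
  proof cases
    \<comment> \<open>Each of the two strands would pass above the other one.\<close>
    case 2
    then have "pt D (snd \<tau>) (over_time D \<tau>') = pt D (snd \<tau>) (under_time D \<tau>)"
      and "pt D (fst \<tau>) (under_time D \<tau>') = pt D (fst \<tau>) (over_time D \<tau>)"
      using eq crossing_pt_under [OF \<tau>] crossing_pt_under [OF \<tau>'] by (auto simp: crossing_pt_def)
    then have "over_time D \<tau>' = under_time D \<tau>" "under_time D \<tau>' = over_time D \<tau>"
      using crossing_edges [OF \<tau>] pt_inj by auto
    then show ?thesis
      using 2 crossing_heights [OF \<tau>] crossing_heights [OF \<tau>'] by simp
  qed
qed

text \<open>Every crossing is passed twice, once above and once below.\<close>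

lemma sum_over_double_times:
  fixes h :: "edge \<Rightarrow> real \<Rightarrow> 'a::ab_group_add"
  shows "(\<Sum>e\<in>edges D. \<Sum>t\<in>double_times D e. h e t) =
    (\<Sum>\<tau>\<in>crossings D. h (fst \<tau>) (over_time D \<tau>) + h (snd \<tau>) (under_time D \<tau>))"
proof -
  let ?o = "\<lambda>\<tau>. (fst \<tau>, over_time D \<tau>)" and ?u = "\<lambda>\<tau>. (snd \<tau>, under_time D \<tau>)"
  have pt: "pt D (fst (?o \<tau>)) (snd (?o \<tau>)) = crossing_pt D \<tau>" "pt D (fst (?u \<tau>)) (snd (?u \<tau>)) = crossing_pt D \<tau>"
    if "\<tau> \<in> crossings D" for \<tau>
    using that crossing_pt_under by (auto simp: crossing_pt_def)
  have inj: "inj_on ?o (crossings D)" "inj_on ?u (crossings D)"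
    by (rule inj_onI, rule crossing_unique, assumption+, metis pt)+
  have disj: "?o ` crossings D \<inter> ?u ` crossings D = {}"
  proof -
    have False if "\<tau> \<in> crossings D" "\<tau>' \<in> crossings D" "?o \<tau> = ?u \<tau>'" for \<tau> \<tau>'
    proof -
      have "\<tau> = \<tau>'"
        using crossing_unique pt that by metis
      then show False
        using that crossing_edges by auto
    qed
    then show ?thesis by blast
  qed
  have "(\<Sum>e\<in>edges D. \<Sum>t\<in>double_times D e. h e t) = (\<Sum>(e, t)\<in>Sigma (edges D) (double_times D). h e t)"
    by (rule sum.Sigma) (simp_all add: finite_edges finite_double_times)
  also have "\<dots> = (\<Sum>(e, t)\<in>?o ` crossings D. h e t) + (\<Sum>(e, t)\<in>?u ` crossings D. h e t)"
    unfolding Sigma_double_times using disj by (intro sum.union_disjoint) (simp_all add: finite_crossings)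
  finally show ?thesis
    by (simp add: sum.reindex [OF inj(1)] sum.reindex [OF inj(2)] sum.distrib)
qed

end


section \<open>Regions to the left of an edge\<close>

definition region_of :: "polylink \<Rightarrow> complex set \<Rightarrow> complex set" where
  "region_of D U = (THE r. r \<in> regions D \<and> U \<subseteq> r)"

definition left_region :: "polylink \<Rightarrow> edge \<Rightarrow> real \<Rightarrow> complex set" where
  "left_region D e t = (THE r. r \<in> regions D \<and> (\<forall>\<^sub>F s in at_right 0. pt D e t + s *\<^sub>R normal D e \<in> r))"

lemma regions_disjoint: "\<lbrakk>r \<in> regions D; r' \<in> regions D; w \<in> r; w \<in> r'\<rbrakk> \<Longrightarrow> r = r'"
  unfolding regions_def using components_eq by blast

lemma region_of:
  assumes "connected U" "U \<noteq> {}" "U \<inter> proj ` link_points D = {}"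
  shows "region_of D U \<in> regions D" "U \<subseteq> region_of D U"
proof -
  have U: "U \<subseteq> - proj ` link_points D" "- proj ` link_points D \<noteq> {}"
    using assms(2,3) by blast+
  obtain r where r: "r \<in> regions D" "U \<subseteq> r"
    using exists_component_superset [OF U assms(1)] by (auto simp: regions_def)
  obtain w where w: "w \<in> U"
    using assms(2) by (auto simp: ex_in_conv [symmetric])
  have "region_of D U = r"
    unfolding region_of_def
  proof (rule the_equality)
    show "r \<in> regions D \<and> U \<subseteq> r"
      using r by simp
    show "r' = r" if "r' \<in> regions D \<and> U \<subseteq> r'" for r'
      using that r w regions_disjoint [of r' D r w] by (simp add: subset_iff)
  qed
  with r show "region_of D U \<in> regions D" "U \<subseteq> region_of D U"
    by auto
qed

lemma region_unique_eventually:
  assumes "F \<noteq> bot" "r \<in> regions D" "\<forall>\<^sub>F s in F. g s \<in> r"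
  shows "(THE r. r \<in> regions D \<and> (\<forall>\<^sub>F s in F. g s \<in> r)) = r"
proof (rule the_equality)
  fix r' assume r': "r' \<in> regions D \<and> (\<forall>\<^sub>F s in F. g s \<in> r')"
  then have "\<forall>\<^sub>F s in F. g s \<in> r \<and> g s \<in> r'"
    using assms(3) by (simp add: eventually_conj)
  then obtain s where "g s \<in> r" "g s \<in> r'"
    using eventually_happens' [OF assms(1)] by blast
  then show "r' = r"
    using regions_disjoint r' assms(2) by blast
qed (use assms in auto)

lemma Im_cnj_normal: "Im (cnj (vec_of D e) * normal D e) = cmod (vec_of D e)"
proof -
  have "cnj (vec_of D e) * sgn (vec_of D e) = of_real (cmod (vec_of D e))"
    by (simp add: sgn_div_norm scaleR_conv_of_real mult.commute [of "cnj _"] complex_norm_square [symmetric]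
        field_simps power2_eq_square)
  moreover have "cnj (vec_of D e) * normal D e = \<i> * (cnj (vec_of D e) * sgn (vec_of D e))"
    by (simp add: normal_def vec_of_def)
  ultimately show ?thesis
    by simp
qed

lemma side_push: "side D e (pt D e t + s *\<^sub>R normal D e) = s * cmod (vec_of D e)"
  by (subst side_diff [of _ _ _ "pt D e t"]) (simp flip: Im_cnj_normal)

lemma open_side: "open {w. 0 < c * side D e w}"
  by (intro open_Collect_less continuous_intros)

lemma convex_side: "convex {w. 0 < c * side D e w}"
proof -
  have "{w. 0 < c * side D e w} = {w. inner (c *\<^sub>R (\<i> * vec_of D e)) w > c * Im (cnj (vec_of D e) * pt D e 0)}"
    by (auto simp: side_def inner_complex_def algebra_simps)
  then show ?thesis
    by (simp only: convex_halfspace_gt)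
qed

lemma tendsto_push: "((\<lambda>s. p + s *\<^sub>R n) \<longlongrightarrow> p) (at_right (0::real))" for p :: complex
  by (rule tendsto_eq_intros | simp)+

context regular_link_diagram
begin

lemma push_left_right:
  assumes "e \<in> edges D" "open W" "pt D e t \<in> W"
  shows "\<forall>\<^sub>F s in at_right 0. pt D e t + s *\<^sub>R normal D e \<in> W \<inter> {w. side D e w > 0}"
    and "\<forall>\<^sub>F s in at_right 0. pt D e t - s *\<^sub>R normal D e \<in> W \<inter> {w. side D e w < 0}"
proof -
  have pos: "\<forall>\<^sub>F s in at_right (0::real). s > 0"
    by (simp add: eventually_at_filter)
  have "\<forall>\<^sub>F s in at_right 0. pt D e t + s *\<^sub>R normal D e \<in> W"
    using topological_tendstoD [OF tendsto_push assms(2,3)] .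
  with pos show "\<forall>\<^sub>F s in at_right 0. pt D e t + s *\<^sub>R normal D e \<in> W \<inter> {w. side D e w > 0}"
    by eventually_elim (simp add: side_push vec_of_nonzero assms)
  have "\<forall>\<^sub>F s in at_right 0. pt D e t + s *\<^sub>R (- normal D e) \<in> W"
    using topological_tendstoD [OF tendsto_push assms(2,3)] .
  with pos show "\<forall>\<^sub>F s in at_right 0. pt D e t - s *\<^sub>R normal D e \<in> W \<inter> {w. side D e w < 0}"
  proof eventually_elim
    case (elim s)
    then show ?case
      using side_push [of D e t "- s"] vec_of_nonzero [OF assms(1)] by simp
  qed
qed

text \<open>The main tool to identify left regions: the part of a neighbourhood that lies to the left of the line
  through the edge need only be contained in a region.\<close>

lemma left_region_eq:
  assumes "e \<in> edges D" "open W" "pt D e t \<in> W" "W \<inter> {w. side D e w > 0} \<subseteq> r" "r \<in> regions D"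
  shows "left_region D e t = r"
  unfolding left_region_def
proof (rule region_unique_eventually [OF trivial_limit_at_right_real assms(5)])
  show "\<forall>\<^sub>F s in at_right 0. pt D e t + s *\<^sub>R normal D e \<in> r"
    using push_left_right(1) [OF assms(1-3)] by eventually_elim (use assms(4) in blast)
qed

end


section \<open>The regions around a point of the diagram\<close>

definition isolating_radius :: "polylink \<Rightarrow> complex \<Rightarrow> real" where
  "isolating_radius D q =
     (SOME \<delta>. 0 < \<delta> \<and> (\<forall>e\<in>edges D. pt D e ` {0..1} \<inter> ball q \<delta> \<noteq> {} \<longrightarrow> q \<in> pt D e ` {0..1}))"

definition near :: "polylink \<Rightarrow> complex \<Rightarrow> complex set" where
  "near D q = ball q (isolating_radius D q)"

text \<open>For signs \<open>a\<close> and \<open>b\<close>, the points near the crossing on the left (\<open>1\<close>) or right (\<open>-1\<close>) of the over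
  strand, according to \<open>a\<close>, and of the under strand, according to \<open>b\<close>. The specified region is the
  one that contains the sector on the right of both strands. Sectors are convex and do not meet the
  diagram, hence each of them lies in a single region, its quadrant.\<close>

definition sector :: "polylink \<Rightarrow> crossing \<Rightarrow> real \<Rightarrow> real \<Rightarrow> complex set" where
  "sector D \<tau> a b = near D (crossing_pt D \<tau>) \<inter>
     {w. 0 < a * side D (fst \<tau>) w} \<inter> {w. 0 < b * side D (snd \<tau>) w}"

definition quadrant :: "polylink \<Rightarrow> crossing \<Rightarrow> real \<Rightarrow> real \<Rightarrow> complex set" where
  "quadrant D \<tau> a b = region_of D (sector D \<tau> a b)"

lemma isolating_radius:
  "0 < isolating_radius D q \<and>
   (\<forall>e\<in>edges D. pt D e ` {0..1} \<inter> near D q \<noteq> {} \<longrightarrow> q \<in> pt D e ` {0..1})"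
  unfolding isolating_radius_def near_def
proof (rule someI_ex)
  define K where "K = (\<Union>e\<in>{e \<in> edges D. q \<notin> pt D e ` {0..1}}. pt D e ` {0..1})"
  have "closed K"
    unfolding K_def
    by (intro closed_UN ballI compact_imp_closed compact_continuous_image continuous_pt) (simp_all add: finite_edges)
  moreover have "q \<in> - K"
    by (auto simp: K_def)
  ultimately obtain \<delta> where \<delta>: "0 < \<delta>" "ball q \<delta> \<subseteq> - K"
    using openE [of "- K" q] by (metis open_Compl)
  have "q \<in> pt D e ` {0..1}" if e: "e \<in> edges D" "pt D e ` {0..1} \<inter> ball q \<delta> \<noteq> {}" for e
  proof (rule ccontr)
    assume "q \<notin> pt D e ` {0..1}"
    with e(1) have "pt D e ` {0..1} \<subseteq> K"
      by (auto simp: K_def)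
    with \<delta>(2) e(2) show False
      by blast
  qed
  with \<delta>(1) have "0 < \<delta> \<and> (\<forall>e\<in>edges D. pt D e ` {0..1} \<inter> ball q \<delta> \<noteq> {} \<longrightarrow> q \<in> pt D e ` {0..1})"
    by simp
  then show "\<exists>\<delta>. 0 < \<delta> \<and> (\<forall>e\<in>edges D. pt D e ` {0..1} \<inter> ball q \<delta> \<noteq> {} \<longrightarrow> q \<in> pt D e ` {0..1})"
    by (rule exI)
qed

lemma centre_near: "q \<in> near D q"
  using isolating_radius [of D q] by (simp add: near_def)

lemma open_near: "open (near D q)"
  by (simp add: near_def)

lemma convex_near: "convex (near D q)"
  by (simp add: near_def)

lemma link_near:
  assumes "w \<in> near D q" "w \<in> proj ` link_points D"
  obtains g s where "g \<in> edges D" "s \<in> {0..1}" "w = pt D g s" "q \<in> pt D g ` {0..1}"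
proof -
  obtain g s where "g \<in> edges D" "s \<in> {0..1}" "w = pt D g s"
    using assms(2) unfolding proj_link_points by blast
  moreover from this have "q \<in> pt D g ` {0..1}"
    using isolating_radius [of D q] assms(1) by blast
  ultimately show thesis
    using that by blast
qed

lemma eventually_pt_near: "\<lbrakk>open W; pt D e t \<in> W\<rbrakk> \<Longrightarrow> \<forall>\<^sub>F s in at t within A. pt D e s \<in> W"
  using topological_tendstoD [OF tendsto_pt] .

lemma eventually_less_greater:
  "\<forall>\<^sub>F s in at_right t. s > (t::real)" "\<forall>\<^sub>F s in at_left t. s < (t::real)"
  by (simp_all add: eventually_at_filter)

lemma side_pt_line: "side D e (pt D f s) = side D e (pt D f t) + (s - t) * cross D e f"
  using side_pt_add [of D e f t "s - t"] by simp

context regular_link_diagram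
begin

lemma side_along_crossing:
  assumes "\<tau> \<in> crossings D"
  shows "side D (snd \<tau>) (pt D (fst \<tau>) s) = - (s - over_time D \<tau>) * cross D (fst \<tau>) (snd \<tau>)"
    and "side D (fst \<tau>) (pt D (snd \<tau>) s) = (s - under_time D \<tau>) * cross D (fst \<tau>) (snd \<tau>)"
proof -
  have "side D (snd \<tau>) (pt D (fst \<tau>) (over_time D \<tau>)) = 0"
    using crossing_pt_under [OF assms] side_pt by (metis crossing_pt_def)
  then show "side D (snd \<tau>) (pt D (fst \<tau>) s) = - (s - over_time D \<tau>) * cross D (fst \<tau>) (snd \<tau>)"
    using side_pt_line [of D "snd \<tau>" "fst \<tau>" s "over_time D \<tau>"] cross_commute [of D "snd \<tau>" "fst \<tau>"]
    by (simp add: algebra_simps)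
  have "side D (fst \<tau>) (pt D (snd \<tau>) (under_time D \<tau>)) = 0"
    using crossing_pt_under [OF assms] side_pt by (metis crossing_pt_def)
  then show "side D (fst \<tau>) (pt D (snd \<tau>) s) = (s - under_time D \<tau>) * cross D (fst \<tau>) (snd \<tau>)"
    using side_pt_line [of D "fst \<tau>" "snd \<tau>" s "under_time D \<tau>"] by simp
qed

text \<open>After the crossing, the over strand is on the right of the under strand if the crossing is positive and
  on its left if it is negative. For the under strand the roles are exchanged.\<close>

lemma eventually_side_over:
  assumes \<tau>: "\<tau> \<in> crossings D" and k: "k = sgn (cross D (fst \<tau>) (snd \<tau>))"
  shows "\<forall>\<^sub>F s in at_right (over_time D \<tau>).
      pt D (fst \<tau>) s \<in> near D (crossing_pt D \<tau>) \<inter> {w. 0 < - k * side D (snd \<tau>) w}"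
    and "\<forall>\<^sub>F s in at_left (over_time D \<tau>).
      pt D (fst \<tau>) s \<in> near D (crossing_pt D \<tau>) \<inter> {w. 0 < k * side D (snd \<tau>) w}"
proof -
  have near: "\<forall>\<^sub>F s in at (over_time D \<tau>) within A. pt D (fst \<tau>) s \<in> near D (crossing_pt D \<tau>)" for A
    by (rule eventually_pt_near [OF open_near]) (use centre_near in \<open>simp add: crossing_pt_def\<close>)
  have c: "cross D (fst \<tau>) (snd \<tau>) \<noteq> 0"
    by (rule crossing_transverse [OF \<tau>])
  have side: "k * side D (snd \<tau>) (pt D (fst \<tau>) s) = (over_time D \<tau> - s) * \<bar>cross D (fst \<tau>) (snd \<tau>)\<bar>" for s
    by (simp add: k side_along_crossing [OF \<tau>] sgn_if algebra_simps)
  have pos: "0 < k * side D (snd \<tau>) (pt D (fst \<tau>) s) \<longleftrightarrow> s < over_time D \<tau>"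
    "0 < - k * side D (snd \<tau>) (pt D (fst \<tau>) s) \<longleftrightarrow> over_time D \<tau> < s" for s
    unfolding minus_mult_left [symmetric] side using c by (simp_all add: zero_less_mult_iff mult_less_0_iff)
  show "\<forall>\<^sub>F s in at_right (over_time D \<tau>).
      pt D (fst \<tau>) s \<in> near D (crossing_pt D \<tau>) \<inter> {w. 0 < - k * side D (snd \<tau>) w}"
    using near eventually_less_greater(1)
    by eventually_elim (simp only: pos Int_iff mem_Collect_eq simp_thms)
  show "\<forall>\<^sub>F s in at_left (over_time D \<tau>).
      pt D (fst \<tau>) s \<in> near D (crossing_pt D \<tau>) \<inter> {w. 0 < k * side D (snd \<tau>) w}"
    using near eventually_less_greater(2)
    by eventually_elim (simp only: pos Int_iff mem_Collect_eq simp_thms)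
qed

lemma eventually_side_under:
  assumes \<tau>: "\<tau> \<in> crossings D" and k: "k = sgn (cross D (fst \<tau>) (snd \<tau>))"
  shows "\<forall>\<^sub>F s in at_right (under_time D \<tau>).
      pt D (snd \<tau>) s \<in> near D (crossing_pt D \<tau>) \<inter> {w. 0 < k * side D (fst \<tau>) w}"
    and "\<forall>\<^sub>F s in at_left (under_time D \<tau>).
      pt D (snd \<tau>) s \<in> near D (crossing_pt D \<tau>) \<inter> {w. 0 < - k * side D (fst \<tau>) w}"
proof -
  have near: "\<forall>\<^sub>F s in at (under_time D \<tau>) within A. pt D (snd \<tau>) s \<in> near D (crossing_pt D \<tau>)" for A
    by (rule eventually_pt_near [OF open_near]) (use centre_near in \<open>simp add: crossing_pt_under [OF \<tau>]\<close>)
  have c: "cross D (fst \<tau>) (snd \<tau>) \<noteq> 0"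
    by (rule crossing_transverse [OF \<tau>])
  have side: "k * side D (fst \<tau>) (pt D (snd \<tau>) s) = (s - under_time D \<tau>) * \<bar>cross D (fst \<tau>) (snd \<tau>)\<bar>" for s
    by (simp add: k side_along_crossing [OF \<tau>] sgn_if algebra_simps)
  have pos: "0 < k * side D (fst \<tau>) (pt D (snd \<tau>) s) \<longleftrightarrow> under_time D \<tau> < s"
    "0 < - k * side D (fst \<tau>) (pt D (snd \<tau>) s) \<longleftrightarrow> s < under_time D \<tau>" for s
    unfolding minus_mult_left [symmetric] side using c by (simp_all add: zero_less_mult_iff mult_less_0_iff)
  show "\<forall>\<^sub>F s in at_right (under_time D \<tau>).
      pt D (snd \<tau>) s \<in> near D (crossing_pt D \<tau>) \<inter> {w. 0 < k * side D (fst \<tau>) w}"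
    using near eventually_less_greater(1)
    by eventually_elim (simp only: pos Int_iff mem_Collect_eq simp_thms)
  show "\<forall>\<^sub>F s in at_left (under_time D \<tau>).
      pt D (snd \<tau>) s \<in> near D (crossing_pt D \<tau>) \<inter> {w. 0 < - k * side D (fst \<tau>) w}"
    using near eventually_less_greater(2)
    by eventually_elim (simp only: pos Int_iff mem_Collect_eq simp_thms)
qed

lemma sgn_cross: "\<tau> \<in> crossings D \<Longrightarrow> sgn (cross D (fst \<tau>) (snd \<tau>)) \<in> {- 1, 1}"
  using crossing_transverse by (auto simp: sgn_if)

lemma sector_nonempty:
  assumes \<tau>: "\<tau> \<in> crossings D" and "a \<in> {- 1, 1}" "b \<in> {- 1, 1}"
  shows "sector D \<tau> a b \<noteq> {}"
proof -
  have "\<exists>s. pt D (snd \<tau>) s \<in> near D (crossing_pt D \<tau>) \<inter> {w. 0 < a * side D (fst \<tau>) w}"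
  proof (cases "a = sgn (cross D (fst \<tau>) (snd \<tau>))")
    case True
    show ?thesis
      using eventually_happens' [OF trivial_limit_at_right_real eventually_side_under(1) [OF \<tau> True]] .
  next
    case False
    then have a: "a = - sgn (cross D (fst \<tau>) (snd \<tau>))"
      using sgn_cross [OF \<tau>] assms(2) by auto
    show ?thesis
      using eventually_happens' [OF trivial_limit_at_left_real eventually_side_under(2) [OF \<tau> HOL.refl]]
      by (simp only: a)
  qed
  then obtain s where s: "pt D (snd \<tau>) s \<in> near D (crossing_pt D \<tau>) \<inter> {w. 0 < a * side D (fst \<tau>) w}"
    by blast
  have W: "open (near D (crossing_pt D \<tau>) \<inter> {w. 0 < a * side D (fst \<tau>) w})"
    by (intro open_Int open_near open_side)
  note push = push_left_right [OF crossing_edges(2) [OF \<tau>] W s]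
  from assms(3) consider "b = 1" | "b = - 1"
    by blast
  then show ?thesis
  proof cases
    case 1
    then show ?thesis
      using eventually_happens' [OF trivial_limit_at_right_real push(1)] by (auto simp: sector_def)
  next
    case 2
    then show ?thesis
      using eventually_happens' [OF trivial_limit_at_right_real push(2)] by (auto simp: sector_def)
  qed
qed

lemma sector_avoids_link:
  assumes \<tau>: "\<tau> \<in> crossings D"
  shows "sector D \<tau> a b \<inter> proj ` link_points D = {}"
proof -
  have False if w: "w \<in> sector D \<tau> a b" "w \<in> proj ` link_points D" for w
  proof -
    have "w \<in> near D (crossing_pt D \<tau>)"
      using w(1) by (simp add: sector_def)
    then obtain g s where g: "g \<in> edges D" "w = pt D g s" "crossing_pt D \<tau> \<in> pt D g ` {0..1}"
      by (rule link_near [OF _ w(2)])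
    then have "w = pt D (fst \<tau>) s \<or> w = pt D (snd \<tau>) s"
      using edges_through_crossing [OF \<tau> g(1,3)] by auto
    then show False
      using w(1) by (auto simp: sector_def)
  qed
  then show ?thesis
    by blast
qed

lemma connected_sector: "connected (sector D \<tau> a b)"
  unfolding sector_def by (intro convex_connected convex_Int convex_near convex_side)

lemma quadrant:
  assumes "\<tau> \<in> crossings D" "a \<in> {- 1, 1}" "b \<in> {- 1, 1}"
  shows "quadrant D \<tau> a b \<in> regions D" "sector D \<tau> a b \<subseteq> quadrant D \<tau> a b"
  unfolding quadrant_def
  using region_of [OF connected_sector sector_nonempty [OF assms] sector_avoids_link [OF assms(1)]] by auto

lemma left_region_over:
  assumes \<tau>: "\<tau> \<in> crossings D" and b: "b \<in> {- 1, 1}"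
    and s: "pt D (fst \<tau>) s \<in> near D (crossing_pt D \<tau>) \<inter> {w. 0 < b * side D (snd \<tau>) w}"
  shows "left_region D (fst \<tau>) s = quadrant D \<tau> 1 b"
proof (rule left_region_eq [OF crossing_edges(1) [OF \<tau>] _ s])
  show "open (near D (crossing_pt D \<tau>) \<inter> {w. 0 < b * side D (snd \<tau>) w})"
    by (intro open_Int open_near open_side)
  show "near D (crossing_pt D \<tau>) \<inter> {w. 0 < b * side D (snd \<tau>) w} \<inter> {w. 0 < side D (fst \<tau>) w} \<subseteq> quadrant D \<tau> 1 b"
    using quadrant(2) [OF \<tau> _ b, of 1] by (auto simp: sector_def)
qed (use quadrant(1) [OF \<tau> _ b] in simp)

lemma left_region_under:
  assumes \<tau>: "\<tau> \<in> crossings D" and a: "a \<in> {- 1, 1}"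
    and s: "pt D (snd \<tau>) s \<in> near D (crossing_pt D \<tau>) \<inter> {w. 0 < a * side D (fst \<tau>) w}"
  shows "left_region D (snd \<tau>) s = quadrant D \<tau> a 1"
proof (rule left_region_eq [OF crossing_edges(2) [OF \<tau>] _ s])
  show "open (near D (crossing_pt D \<tau>) \<inter> {w. 0 < a * side D (fst \<tau>) w})"
    by (intro open_Int open_near open_side)
  show "near D (crossing_pt D \<tau>) \<inter> {w. 0 < a * side D (fst \<tau>) w} \<inter> {w. 0 < side D (snd \<tau>) w} \<subseteq> quadrant D \<tau> a 1"
    using quadrant(2) [OF \<tau> a, of 1] by (auto simp: sector_def)
qed (use quadrant(1) [OF \<tau> a] in simp)

text \<open>The left region of a strand changes at a crossing because the other strand is crossed, from one of
  its sides to the other.\<close>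

lemma left_regions_at_crossing:
  assumes \<tau>: "\<tau> \<in> crossings D" and k: "k = sgn (cross D (fst \<tau>) (snd \<tau>))"
  shows "\<forall>\<^sub>F s in at_right (over_time D \<tau>). left_region D (fst \<tau>) s = quadrant D \<tau> 1 (- k)"
    and "\<forall>\<^sub>F s in at_left (over_time D \<tau>). left_region D (fst \<tau>) s = quadrant D \<tau> 1 k"
    and "\<forall>\<^sub>F s in at_right (under_time D \<tau>). left_region D (snd \<tau>) s = quadrant D \<tau> k 1"
    and "\<forall>\<^sub>F s in at_left (under_time D \<tau>). left_region D (snd \<tau>) s = quadrant D \<tau> (- k) 1"
proof -
  have k': "k \<in> {- 1, 1}" "- k \<in> {- 1, 1}"
    using sgn_cross [OF \<tau>] k by auto
  show "\<forall>\<^sub>F s in at_right (over_time D \<tau>). left_region D (fst \<tau>) s = quadrant D \<tau> 1 (- k)"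
    using eventually_side_over(1) [OF \<tau> k] by eventually_elim (rule left_region_over [OF \<tau> k'(2)])
  show "\<forall>\<^sub>F s in at_left (over_time D \<tau>). left_region D (fst \<tau>) s = quadrant D \<tau> 1 k"
    using eventually_side_over(2) [OF \<tau> k] by eventually_elim (rule left_region_over [OF \<tau> k'(1)])
  show "\<forall>\<^sub>F s in at_right (under_time D \<tau>). left_region D (snd \<tau>) s = quadrant D \<tau> k 1"
    using eventually_side_under(1) [OF \<tau> k] by eventually_elim (rule left_region_under [OF \<tau> k'(1)])
  show "\<forall>\<^sub>F s in at_left (under_time D \<tau>). left_region D (snd \<tau>) s = quadrant D \<tau> (- k) 1"
    using eventually_side_under(2) [OF \<tau> k] by eventually_elim (rule left_region_under [OF \<tau> k'(2)])
qed

lemma left_region_locally_constant: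
  assumes e: "e \<in> edges D" and t: "t \<in> {0<..<1} - double_times D e"
  shows "\<forall>\<^sub>F s in at t. left_region D e s = left_region D e t"
proof -
  define W where "W = near D (pt D e t)"
  define U where "U = W \<inter> {w. 0 < side D e w}"
  have W: "open W" "pt D e t \<in> W"
    by (simp_all add: W_def open_near centre_near)
  have "U \<noteq> {}"
    using eventually_happens' [OF trivial_limit_at_right_real push_left_right(1) [OF e W]] by (auto simp: U_def)
  moreover have "connected U"
    using convex_side [of 1 D e] unfolding U_def W_def by (intro convex_connected convex_Int convex_near) simp
  moreover have False if w: "w \<in> U" "w \<in> proj ` link_points D" for w
  proof -
    have "w \<in> near D (pt D e t)"
      using w(1) by (simp add: U_def W_def)
    then obtain g s where g: "g \<in> edges D" "w = pt D g s" "pt D e t \<in> pt D g ` {0..1}"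
      by (rule link_near [OF _ w(2)])
    then have "g = e"
      using t by (auto simp: double_times_def)
    then show False
      using w(1) g by (simp add: U_def)
  qed
  ultimately have r: "region_of D U \<in> regions D" "U \<subseteq> region_of D U"
    using region_of [of U D] by blast+
  have left: "left_region D e s = region_of D U" if "pt D e s \<in> W" for s
    using left_region_eq [OF e W(1) that _ r(1)] r(2) by (simp add: U_def)
  have "\<forall>\<^sub>F s in at t. pt D e s \<in> W"
    by (rule eventually_pt_near [OF W])
  then show ?thesis
    by eventually_elim (simp add: left W)
qed

text \<open>If an edge turned back by a straight angle, it would share interior points with its predecessor and be
  parallel to it.\<close>

lemma consecutive_edges:
  assumes e: "e \<in> edges D" and f: "f = next_edge D e" and c: "cross D e f = 0"
  obtains k where "k > 0" "vec_of D f = k *\<^sub>R vec_of D e"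
proof -
  have fE: "f \<in> edges D" and ne: "e \<noteq> f"
    using e next_edge_in_edges next_edge_neq(1) [OF e] by (auto simp: f)
  obtain k where k: "k \<noteq> 0" "vec_of D f = k *\<^sub>R vec_of D e"
    using parallel_edges [OF e fE c] .
  have "k > 0"
  proof (rule ccontr)
    assume "\<not> k > 0"
    then have neg: "k < 0"
      using k by simp
    define u where "u = 1 / (2 * (1 - k))"
    have u: "u \<in> {0<..<1}" "1 + u * k \<in> {0<..<1}"
      using neg by (auto simp: u_def field_simps)
    have "pt D f u = pt D e (1 + u * k)"
      using pt_add [of D f 0 u] pt_add [of D e 1 "u * k"] k by (simp add: f pt_next_edge)
    then show False
      using double_point_transverse [OF e fE ne u(2,1)] c by simp
  qed
  with k that show thesis
    by blast
qed

text \<open>The left sides of two consecutive edges near their common vertex \<open>v\<close> are joined by a connected set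
  that avoids the diagram. It depends on the direction of the turn whether the intersection or the
  union of the two half discs on the left has this property.\<close>

lemma left_region_at_vertex:
  assumes e: "e \<in> edges D" and f: "f = next_edge D e"
  shows "\<exists>r. (\<forall>\<^sub>F s in at_left 1. left_region D e s = r) \<and> (\<forall>\<^sub>F s in at_right 0. left_region D f s = r)"
proof -
  define v where "v = pt D e 1"
  define L where "L g = near D v \<inter> {w. 0 < side D g w}" for g
  have fE: "f \<in> edges D"
    using e next_edge_in_edges by (simp add: f)
  have vf: "v = pt D f 0"
    by (simp add: v_def f pt_next_edge)
  have side_e: "side D e (pt D f s) = s * cross D e f" for s
    using side_pt_line [of D e f s 0] vf side_pt [of D e 1] by (simp add: v_def)
  have side_f: "side D f (pt D e s) = (1 - s) * cross D e f" for s
    using side_pt_line [of D f e s 1] vf side_pt [of D f 0] cross_commute [of D f e]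
    by (simp add: v_def algebra_simps)
  have near_e: "\<forall>\<^sub>F s in at_left 1. pt D e s \<in> near D v \<and> s < 1"
    by (intro eventually_conj eventually_pt_near open_near eventually_less_greater)
       (simp add: centre_near flip: v_def)
  have near_f: "\<forall>\<^sub>F s in at_right 0. pt D f s \<in> near D v \<and> 0 < s"
    by (intro eventually_conj eventually_pt_near open_near eventually_less_greater)
       (simp add: centre_near flip: vf)
  have L: "open (L g)" "convex (L g)" for g
    using open_side [of 1 D g] convex_side [of 1 D g]
    by (simp_all add: L_def open_Int open_near convex_Int convex_near)
  have link: "w \<in> pt D e ` {..1} \<or> w \<in> pt D f ` {0..}" if w: "w \<in> near D v" "w \<in> proj ` link_points D" for w
  proof -
    obtain g s where g: "g \<in> edges D" "s \<in> {0..1}" "w = pt D g s" "v \<in> pt D g ` {0..1}"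
      by (rule link_near [OF w])
    then have "g = e \<or> g = f"
      using vertex_at_end [OF e g(1)] by (auto simp: v_def f)
    then show ?thesis
      using g by auto
  qed
  have Le: "\<exists>w. w \<in> A \<inter> {w. 0 < side D e w}" if A: "\<forall>\<^sub>F s in at_left 1. pt D e s \<in> A" "open A" for A
  proof -
    obtain s where s: "pt D e s \<in> A"
      using eventually_happens' [OF trivial_limit_at_left_real A(1)] by blast
    show ?thesis
      using eventually_happens' [OF trivial_limit_at_right_real push_left_right(1) [OF e A(2) s]] by blast
  qed
  consider "cross D e f > 0" | "cross D e f = 0" | "cross D e f < 0"
    by linarith
  then show ?thesis
  proof cases
    \<comment> \<open>A left turn: the left side of the corner is the intersection of two half planes.\<close>
    case 1
    define U where "U = L e \<inter> L f"
    have e_near: "\<forall>\<^sub>F s in at_left 1. pt D e s \<in> L f"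
      using near_e by eventually_elim (use 1 in \<open>simp add: L_def side_f\<close>)
    have f_near: "\<forall>\<^sub>F s in at_right 0. pt D f s \<in> L e"
      using near_f by eventually_elim (use 1 in \<open>simp add: L_def side_e\<close>)
    have "U \<noteq> {}"
      using Le [OF e_near L(1)] by (auto simp: U_def L_def)
    moreover have "connected U"
      unfolding U_def by (intro convex_connected convex_Int L)
    moreover have "U \<inter> proj ` link_points D = {}"
      using link by (fastforce simp: U_def L_def)
    ultimately have r: "region_of D U \<in> regions D" "U \<subseteq> region_of D U"
      using region_of [of U D] by blast+
    have "\<forall>\<^sub>F s in at_left 1. left_region D e s = region_of D U"
      using e_near by eventually_elim (rule left_region_eq [OF e L(1) _ _ r(1)], assumption, use r(2) in \<open>auto simp: U_def L_def\<close>)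
    moreover have "\<forall>\<^sub>F s in at_right 0. left_region D f s = region_of D U"
      using f_near by eventually_elim (rule left_region_eq [OF fE L(1) _ _ r(1)], assumption, use r(2) in \<open>auto simp: U_def L_def\<close>)
    ultimately show ?thesis
      by blast
  next
    case 2
    then obtain k where k: "k > 0" "vec_of D f = k *\<^sub>R vec_of D e"
      using consecutive_edges [OF e f] by blast
    have "side D f w = k * side D e w" for w
    proof -
      have "side D f w = Im (cnj (vec_of D f) * (w - v))"
        by (simp add: side_def vf)
      also have "\<dots> = k * Im (cnj (vec_of D e) * (w - v))"
        by (simp add: k algebra_simps)
      also have "Im (cnj (vec_of D e) * (w - v)) = side D e w"
        using side_diff [of D e w v] by (simp add: v_def)
      finally show ?thesis .
    qed
    then have Lf: "L f = L e"
      using k by (simp add: L_def zero_less_mult_iff)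
    have "L e \<noteq> {}"
      using Le [of "near D v"] eventually_mono [OF near_e] open_near by (auto simp: L_def)
    moreover have "L e \<inter> proj ` link_points D = {}"
      using link Lf by (fastforce simp: L_def)
    ultimately have r: "region_of D (L e) \<in> regions D" "L e \<subseteq> region_of D (L e)"
      using region_of [of "L e" D] L by (blast intro: convex_connected)+
    have "\<forall>\<^sub>F s in at_left 1. left_region D e s = region_of D (L e)"
      using near_e by eventually_elim (rule left_region_eq [OF e open_near _ _ r(1)], erule conjunct1, use r(2) in \<open>simp add: L_def\<close>)
    moreover have "\<forall>\<^sub>F s in at_right 0. left_region D f s = region_of D (L e)"
      using near_f by eventually_elim (rule left_region_eq [OF fE open_near _ _ r(1)], erule conjunct1, use r(2) Lf in \<open>simp add: L_def\<close>)
    ultimately show ?thesis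
      by blast
  next
    \<comment> \<open>A right turn: the left side of the corner is the union of two half planes.\<close>
    case 3
    define U where "U = L e \<union> L f"
    have "\<forall>\<^sub>F s in at_right 1. pt D e s \<in> near D v \<and> 1 < s"
      by (intro eventually_conj eventually_pt_near open_near eventually_less_greater)
         (simp add: centre_near flip: v_def)
    \<comment> \<open>The prolongation of the first edge beyond the corner lies to the left of the second edge.\<close>
    then have "\<forall>\<^sub>F s in at_right 1. pt D e s \<in> L f"
      by eventually_elim (use 3 in \<open>simp add: L_def side_f mult_neg_neg\<close>)
    then obtain s where s: "pt D e s \<in> L f"
      using eventually_happens' [OF trivial_limit_at_right_real] by blast
    have "L e \<inter> L f \<noteq> {}"
      using eventually_happens' [OF trivial_limit_at_right_real push_left_right(1) [OF e L(1) s]]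
      by (auto simp: L_def)
    then have "connected U"
      unfolding U_def by (intro connected_Un convex_connected L)
    moreover have "L e \<noteq> {}"
      using \<open>L e \<inter> L f \<noteq> {}\<close> by blast
    moreover have "U \<inter> proj ` link_points D = {}"
    proof -
      have False if w: "w \<in> U" "w \<in> proj ` link_points D" for w
      proof -
        have "w \<in> pt D e ` {..1} \<or> w \<in> pt D f ` {0..}"
          using link [of w] w by (auto simp: U_def L_def)
        then show False
          using w(1) 3 by (auto simp: U_def L_def side_e side_f zero_less_mult_iff)
      qed
      then show ?thesis
        by blast
    qed
    ultimately have r: "region_of D U \<in> regions D" "U \<subseteq> region_of D U"
      using region_of [of U D] by (auto simp: U_def)
    have "\<forall>\<^sub>F s in at_left 1. left_region D e s = region_of D U"
      using near_e by eventually_elim (rule left_region_eq [OF e open_near _ _ r(1)], erule conjunct1, use r(2) in \<open>auto simp: U_def L_def\<close>)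
    moreover have "\<forall>\<^sub>F s in at_right 0. left_region D f s = region_of D U"
      using near_f by eventually_elim (rule left_region_eq [OF fE open_near _ _ r(1)], erule conjunct1, use r(2) in \<open>auto simp: U_def L_def\<close>)
    ultimately show ?thesis
      by blast
  qed
qed

end


section \<open>The sum over the crossings\<close>

context regular_link_diagram
begin

lemma crossing_sign_eq:
  "\<tau> \<in> crossings D \<Longrightarrow> real_of_int (crossing_sign D \<tau>) = sgn (cross D (fst \<tau>) (snd \<tau>))"
  using crossing_transverse [of \<tau>] by (simp add: crossing_sign_def cross_def vec_of_def sgn_if)

text \<open>Both jumps at a crossing involve the quadrant on the left of both strands, and it cancels: at a
  positive crossing the jumps are \<open>\<alpha> (1, - 1) - \<alpha> (1, 1)\<close> for the over strand and
  \<open>\<alpha> (1, 1) - \<alpha> (- 1, 1)\<close> for the under strand, where \<open>\<alpha> (a, b)\<close> is the value at the quadrant with these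
  signs; at a negative crossing both are reversed. So the sum in question is minus the sum of all jumps, which telescopes along each edge; what remains
  at the vertices cancels because consecutive edges share the left region there.\<close>

lemma sum_opposite_quadrants:
  fixes \<alpha> :: "complex set \<Rightarrow> 'a::ab_group_add"
  shows "(\<Sum>\<tau>\<in>crossings D. int_mult (crossing_sign D \<tau>)
            (\<alpha> (quadrant D \<tau> (- 1) 1) - \<alpha> (quadrant D \<tau> 1 (- 1)))) = 0"
proof -
  define \<beta> where "\<beta> e s = \<alpha> (left_region D e s)" for e s
  obtain V where V: "\<And>e. e \<in> edges D \<Longrightarrow>
      (\<forall>\<^sub>F s in at_left 1. left_region D e s = V e) \<and>
      (\<forall>\<^sub>F s in at_right 0. left_region D (next_edge D e) s = V e)"
    using left_region_at_vertex by metis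
  define prev where "prev = inv_into (edges D) (next_edge D)"
  have prev: "prev e \<in> edges D" "next_edge D (prev e) = e" if "e \<in> edges D" for e
    using that next_edge_image by (metis prev_def inv_into_into, metis prev_def f_inv_into_f)
  have bij: "bij_betw prev (edges D) (edges D)"
    unfolding prev_def using next_edge_inj next_edge_image
    by (intro bij_betw_inv_into) (simp add: bij_betw_def)
  have limits: "(\<forall>\<^sub>F s in at_right (over_time D \<tau>). \<beta> (fst \<tau>) s = \<alpha> (quadrant D \<tau> 1 (- k))) \<and>
      (\<forall>\<^sub>F s in at_left (over_time D \<tau>). \<beta> (fst \<tau>) s = \<alpha> (quadrant D \<tau> 1 k)) \<and>
      (\<forall>\<^sub>F s in at_right (under_time D \<tau>). \<beta> (snd \<tau>) s = \<alpha> (quadrant D \<tau> k 1)) \<and>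
      (\<forall>\<^sub>F s in at_left (under_time D \<tau>). \<beta> (snd \<tau>) s = \<alpha> (quadrant D \<tau> (- k) 1))"
    if "\<tau> \<in> crossings D" "k = sgn (cross D (fst \<tau>) (snd \<tau>))" for \<tau> k
  proof -
    have "\<forall>\<^sub>F s in F. \<beta> e s = \<alpha> r" if "\<forall>\<^sub>F s in F. left_region D e s = r" for F e r
      using that by eventually_elim (simp add: \<beta>_def)
    then show ?thesis
      using left_regions_at_crossing [OF that] by simp
  qed
  have edge: "(\<Sum>t\<in>double_times D e. jump (\<beta> e) t) = \<alpha> (V e) - \<alpha> (V (prev e))" if e: "e \<in> edges D" for e
  proof (rule sum_jumps)
    show "finite (double_times D e)" "double_times D e \<subseteq> {0<..<1}"
      using finite_double_times [OF e] by (auto simp: double_times_def)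
    show "\<forall>\<^sub>F s in at t. \<beta> e s = \<beta> e t" if "t \<in> {0<..<1} - double_times D e" for t
      using left_region_locally_constant [OF e that] by eventually_elim (simp add: \<beta>_def)
    show "\<exists>p m. (\<forall>\<^sub>F s in at_right t. \<beta> e s = p) \<and> (\<forall>\<^sub>F s in at_left t. \<beta> e s = m)"
      if t: "t \<in> double_times D e" for t
    proof -
      have "(e, t) \<in> Sigma (edges D) (double_times D)"
        using e t by simp
      then obtain \<tau> where "\<tau> \<in> crossings D" "e = fst \<tau> \<and> t = over_time D \<tau> \<or> e = snd \<tau> \<and> t = under_time D \<tau>"
        unfolding Sigma_double_times by auto
      then show ?thesis
        using limits [OF _ HOL.refl, of \<tau>] by blast
    qed
    show "\<forall>\<^sub>F s in at_right 0. \<beta> e s = \<alpha> (V (prev e))"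
      using V [OF prev(1) [OF e], THEN conjunct2] by eventually_elim (simp add: \<beta>_def prev(2) [OF e])
    show "\<forall>\<^sub>F s in at_left 1. \<beta> e s = \<alpha> (V e)"
      using V [OF e, THEN conjunct1] by eventually_elim (simp add: \<beta>_def)
  qed
  have cross: "int_mult (crossing_sign D \<tau>) (\<alpha> (quadrant D \<tau> (- 1) 1) - \<alpha> (quadrant D \<tau> 1 (- 1))) =
      - (jump (\<beta> (fst \<tau>)) (over_time D \<tau>) + jump (\<beta> (snd \<tau>)) (under_time D \<tau>))"
    if \<tau>: "\<tau> \<in> crossings D" for \<tau>
  proof -
    define k where "k = sgn (cross D (fst \<tau>) (snd \<tau>))"
    have "jump (\<beta> (fst \<tau>)) (over_time D \<tau>) = \<alpha> (quadrant D \<tau> 1 (- k)) - \<alpha> (quadrant D \<tau> 1 k)"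
      "jump (\<beta> (snd \<tau>)) (under_time D \<tau>) = \<alpha> (quadrant D \<tau> k 1) - \<alpha> (quadrant D \<tau> (- k) 1)"
      using limits [OF \<tau> k_def] by (simp_all add: jump_eq)
    moreover have "k = 1 \<and> crossing_sign D \<tau> = 1 \<or> k = - 1 \<and> crossing_sign D \<tau> = - 1"
      using crossing_sign_eq [OF \<tau>] by (auto simp: k_def crossing_sign_def split: if_splits)
    ultimately show ?thesis
      by auto
  qed
  have "(\<Sum>\<tau>\<in>crossings D. jump (\<beta> (fst \<tau>)) (over_time D \<tau>) + jump (\<beta> (snd \<tau>)) (under_time D \<tau>)) =
      (\<Sum>e\<in>edges D. \<alpha> (V e) - \<alpha> (V (prev e)))"
    using sum_over_double_times [of "\<lambda>e. jump (\<beta> e)"] by (simp add: edge)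
  also have "\<dots> = 0"
    using sum.reindex_bij_betw [OF bij, of "\<lambda>e. \<alpha> (V e)"] by (simp add: sum_subtractf)
  finally show ?thesis
    by (simp add: cross sum_negf del: minus_add_distrib)
qed

end


section \<open>Arcs and labels around a crossing\<close>

text \<open>The sum of the two unit normals at a crossing points to the left of both strands: the contribution of
  the strand itself outweighs that of the other one, since two unit vectors that are not parallel have
  inner product greater than \<open>-1\<close>.\<close>

lemma Im_cnj_normals_pos:
  assumes "vec_of D e \<noteq> 0" "vec_of D f \<noteq> 0" "cross D e f \<noteq> 0"
  shows "0 < Im (cnj (vec_of D e) * (normal D e + normal D f))"
proof -
  define z where "z = cnj (vec_of D e) * sgn (vec_of D f)"
  have "Im z = cross D e f / cmod (vec_of D f)"
    by (simp add: z_def cross_def sgn_div_norm field_simps)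
  then have "Im z \<noteq> 0"
    using assms by simp
  then have "(Re z)\<^sup>2 < (cmod z)\<^sup>2"
    by (simp add: cmod_power2)
  then have "\<bar>Re z\<bar> < cmod z"
    by (metis abs_norm_cancel power2_less_imp_less abs_ge_zero power2_abs norm_ge_zero)
  moreover have "cmod z = cmod (vec_of D e)"
    using assms by (simp add: z_def norm_mult norm_sgn)
  moreover have "cnj (vec_of D e) * normal D f = \<i> * z"
    by (simp add: normal_def z_def vec_of_def)
  then have "Im (cnj (vec_of D e) * normal D f) = Re z"
    by simp
  ultimately show ?thesis
    by (simp only: distrib_left plus_complex.sel Im_cnj_normal)
qed

lemma inner_normal: "inner (normal D e) w = Im (cnj (vec_of D e) * w) / cmod (vec_of D e)"
  by (simp add: normal_def vec_of_def inner_complex_def sgn_div_norm divide_inverse algebra_simps)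

lemma arc_at_constant:
  assumes "connected S" "S \<subseteq> cut_link D" "p \<in> S" "q \<in> S"
  shows "arc_at D q = arc_at D p" "q \<in> arc_at D p" "arc_at D p \<in> arcs D"
proof -
  show "q \<in> arc_at D p"
    using connected_component_maximal [OF assms(3,1,2)] assms(4) by (auto simp: arc_at_def)
  then show "arc_at D q = arc_at D p"
    unfolding arc_at_def by (rule connected_component_eq)
  show "arc_at D p \<in> arcs D"
    using assms(2,3) by (auto simp: arcs_def arc_at_def intro: componentsI)
qed

context regular_link_diagram
begin

lemma specified_region_eq:
  assumes \<tau>: "\<tau> \<in> crossings D"
  shows "specified_region D \<tau> = quadrant D \<tau> (- 1) (- 1)"
proof -
  define n where "n = normal D (fst \<tau>) + normal D (snd \<tau>)"
  define q where "q = crossing_pt D \<tau>"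
  have c: "cross D (fst \<tau>) (snd \<tau>) \<noteq> 0" "cross D (snd \<tau>) (fst \<tau>) \<noteq> 0"
    using crossing_transverse [OF \<tau>] cross_commute [of D "snd \<tau>" "fst \<tau>"] by auto
  have n: "0 < Im (cnj (vec_of D (fst \<tau>)) * n)" "0 < Im (cnj (vec_of D (snd \<tau>)) * n)"
    using Im_cnj_normals_pos c vec_of_nonzero crossing_edges [OF \<tau>] unfolding n_def
    by (metis, metis add.commute)
  have q: "side D (fst \<tau>) q = 0" "side D (snd \<tau>) q = 0"
    unfolding q_def using crossing_pt_under [OF \<tau>] side_pt by (metis crossing_pt_def, metis)
  have side: "side D e (q + s *\<^sub>R (- n)) = side D e q - s * Im (cnj (vec_of D e) * n)" for e s
    by (subst side_diff [of _ _ _ q]) (simp add: algebra_simps)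
  have "\<forall>\<^sub>F s in at_right 0. q + s *\<^sub>R (- n) \<in> near D q"
    by (rule topological_tendstoD [OF tendsto_push open_near centre_near])
  then have "\<forall>\<^sub>F s in at_right 0. q + s *\<^sub>R (- n) \<in> sector D \<tau> (- 1) (- 1)"
    using eventually_less_greater(1)
    by eventually_elim (unfold sector_def Int_iff mem_Collect_eq side q q_def [symmetric], use n in simp)
  then have "\<forall>\<^sub>F s in at_right 0. q - s *\<^sub>R n \<in> quadrant D \<tau> (- 1) (- 1)"
    by eventually_elim (use quadrant(2) [OF \<tau>, of "- 1" "- 1"] in auto)
  moreover have "quadrant D \<tau> (- 1) (- 1) \<in> regions D"
    using quadrant(1) [OF \<tau>] by simp
  ultimately have "(THE r. r \<in> regions D \<and> (\<forall>\<^sub>F s in at_right 0. q - s *\<^sub>R n \<in> r)) = quadrant D \<tau> (- 1) (- 1)"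
    by (intro region_unique_eventually [OF trivial_limit_at_right_real])
  then show ?thesis
    by (simp add: specified_region_def proj_under_point [OF \<tau>] q_def n_def)
qed

lemma eventually_not_under:
  assumes e: "e \<in> edges D" and t: "t \<in> {0<..<1}"
  shows "\<forall>\<^sub>F s in at t within A. s \<in> {0<..<1} \<and> pt D e s \<notin> proj ` under_point D ` crossings D"
proof -
  let ?U = "proj ` under_point D ` crossings D - {pt D e t}"
  have "open (- ?U)"
    by (intro open_Compl finite_imp_closed) (simp add: finite_crossings)
  then have "\<forall>\<^sub>F s in at t within A. pt D e s \<in> - ?U"
    by (intro eventually_pt_near) simp_all
  moreover have "\<forall>\<^sub>F s in at t within A. s \<noteq> t"
    by (simp add: eventually_at_filter)
  moreover have "\<forall>\<^sub>F s in at t within A. s \<in> {0<..<1}"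
    using topological_tendstoD [OF tendsto_ident_at open_greaterThanLessThan t] .
  ultimately show ?thesis
    by eventually_elim (use pt_inj [OF e] in auto)
qed

lemma lift_in_cut_link:
  assumes "e \<in> edges D" "t \<in> {0<..<1}" "pt D e t \<notin> proj ` under_point D ` crossings D"
  shows "lift D e t \<in> cut_link D"
proof -
  have "lift D e t \<in> edge_points D e"
    using assms(2) by (auto simp: edge_points_eq)
  then show ?thesis
    using assms(1,3) by (auto simp: cut_link_def link_points_def pt_def)
qed

lemma over_point_in_cut_link:
  assumes \<tau>: "\<tau> \<in> crossings D"
  shows "lift D (fst \<tau>) (over_time D \<tau>) \<in> cut_link D"
proof -
  have "lift D (fst \<tau>) (over_time D \<tau>) \<noteq> under_point D \<tau>'" if \<tau>': "\<tau>' \<in> crossings D" for \<tau>'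
  proof
    assume eq: "lift D (fst \<tau>) (over_time D \<tau>) = under_point D \<tau>'"
    then have "crossing_pt D \<tau> = crossing_pt D \<tau>'"
      using proj_under_point [OF \<tau>'] by (simp add: crossing_pt_def pt_def)
    then have "\<tau> = \<tau>'"
      by (rule crossing_unique [OF \<tau> \<tau>'])
    then show False
      using eq crossing_points(2) [OF \<tau>] crossing_heights [OF \<tau>] by simp
  qed
  moreover have "lift D (fst \<tau>) (over_time D \<tau>) \<in> edge_points D (fst \<tau>)"
    using crossing_times [OF \<tau>] by (auto simp: edge_points_eq)
  ultimately show ?thesis
    using crossing_edges [OF \<tau>] by (auto simp: cut_link_def link_points_def)
qed

lemma arc_near_over_point:
  assumes \<tau>: "\<tau> \<in> crossings D"
  shows "over_arc D \<tau> \<in> arcs D"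
    and "\<forall>\<^sub>F s in at (over_time D \<tau>) within A. arc_at D (lift D (fst \<tau>) s) = over_arc D \<tau>"
proof -
  let ?e = "fst \<tau>" and ?t = "over_time D \<tau>"
  have e: "?e \<in> edges D" and t: "?t \<in> {0<..<1}"
    using crossing_edges [OF \<tau>] crossing_times [OF \<tau>] by auto
  obtain d where d: "d > 0" "\<And>s. s \<noteq> ?t \<Longrightarrow> dist s ?t < d \<Longrightarrow>
      s \<in> {0<..<1} \<and> pt D ?e s \<notin> proj ` under_point D ` crossings D"
    using eventually_not_under [OF e t, of UNIV] by (auto simp: eventually_at)
  define S where "S = lift D ?e ` ball ?t d"
  have S: "connected S" "S \<subseteq> cut_link D" "lift D ?e ?t \<in> S"
    using d over_point_in_cut_link [OF \<tau>] lift_in_cut_link [OF e]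
    by (auto simp: S_def dist_commute intro!: connected_continuous_image continuous_lift) metis
  have over: "over_arc D \<tau> = arc_at D (lift D ?e ?t)"
    by (simp add: over_arc_def crossing_points [OF \<tau>])
  show "over_arc D \<tau> \<in> arcs D"
    using arc_at_constant(3) [OF S S(3)] over by simp
  have "\<forall>\<^sub>F s in at ?t within A. s \<in> ball ?t d"
    using topological_tendstoD [OF tendsto_ident_at open_ball, of ?t ?t d] d(1) by simp
  then show "\<forall>\<^sub>F s in at ?t within A. arc_at D (lift D ?e s) = over_arc D \<tau>"
    by eventually_elim (use arc_at_constant(1) [OF S] over in \<open>simp add: S_def\<close>)
qed

text \<open>On either side of an interior point of an edge, undercrossing or not, a short piece of the edge contains
  no undercrossings and therefore lies in a single arc.\<close>

lemma one_sided_arc: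
  assumes e: "e \<in> edges D" and t: "t \<in> {0<..<1}" and F: "F = at_left t \<or> F = at_right t"
  shows "\<exists>a\<in>arcs D. \<forall>\<^sub>F s in F. arc_at D (lift D e s) = a \<and> lift D e s \<in> a"
proof -
  obtain I where I: "connected I" "I \<noteq> {}" "\<forall>\<^sub>F s in F. s \<in> I"
    and cut: "\<And>s. s \<in> I \<Longrightarrow> s \<in> {0<..<1} \<and> pt D e s \<notin> proj ` under_point D ` crossings D"
    using F
  proof
    assume F: "F = at_left t"
    obtain b where b: "b < t" "\<And>s. b < s \<Longrightarrow> s < t \<Longrightarrow> s \<in> {0<..<1} \<and> pt D e s \<notin> proj ` under_point D ` crossings D"
      using eventually_not_under [OF e t, of "{..<t}"] by (auto simp: eventually_at_left_field)
    show thesis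
      by (rule that [of "{b<..<t}"]) (use b F in \<open>auto simp: eventually_at_left_field\<close>)
  next
    assume F: "F = at_right t"
    obtain b where b: "t < b" "\<And>s. t < s \<Longrightarrow> s < b \<Longrightarrow> s \<in> {0<..<1} \<and> pt D e s \<notin> proj ` under_point D ` crossings D"
      using eventually_not_under [OF e t, of "{t<..}"] by (auto simp: eventually_at_right_field)
    show thesis
      by (rule that [of "{t<..<b}"]) (use b F in \<open>auto simp: eventually_at_right_field\<close>)
  qed
  obtain s0 where s0: "s0 \<in> I"
    using I(2) by blast
  have S: "connected (lift D e ` I)" "lift D e ` I \<subseteq> cut_link D" "lift D e s0 \<in> lift D e ` I"
    using I(1) cut lift_in_cut_link [OF e] s0
    by (auto intro!: connected_continuous_image continuous_lift)
  have "\<forall>\<^sub>F s in F. arc_at D (lift D e s) = arc_at D (lift D e s0) \<and> lift D e s \<in> arc_at D (lift D e s0)"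
    using I(3) by eventually_elim (use arc_at_constant [OF S] in simp)
  then show ?thesis
    using arc_at_constant(3) [OF S S(3)] by blast
qed

end

text \<open>For a crossing of sign \<open>k\<close>, the filter \<open>before_side k\<close> describes the times at which the under strand is
  near the crossing and on the right of the over strand. The over strand is on the right of the
  under strand at the times described by \<open>before_side (- k)\<close>.\<close>

definition before_side :: "real \<Rightarrow> real \<Rightarrow> real filter" where
  "before_side k t = (if k = 1 then at_left t else at_right t)"

lemma before_side_eq: "before_side k t = at t within (if k = 1 then {..<t} else {t<..})"
  by (simp add: before_side_def)

lemma before_side_nontrivial: "before_side k t \<noteq> bot"
  by (simp add: before_side_def trivial_limit_at_left_real trivial_limit_at_right_real)

lemma filterlim_before_side:
  assumes "k \<in> {- 1, 1}"
  shows "filterlim (\<lambda>s. t - k * s) (before_side k t) (at_right 0)"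
proof -
  have "((\<lambda>s. t - k * s) \<longlongrightarrow> t) (at_right 0)"
    by (rule tendsto_eq_intros | simp)+
  then show ?thesis
    using assms eventually_less_greater(1) [of 0]
    by (auto simp: before_side_def filterlim_at elim!: eventually_mono)
qed

context regular_link_diagram
begin

text \<open>The normal of the over arc points to its left, so the direction singled out in the definition of
  \<open>under_arc_from\<close> is the one that leads to the right of the over strand.\<close>

lemma under_arc_from_near:
  assumes \<tau>: "\<tau> \<in> crossings D" and k: "k = sgn (cross D (fst \<tau>) (snd \<tau>))"
  shows "under_arc_from D \<tau> \<in> arcs D"
    and "\<forall>\<^sub>F s in before_side k (under_time D \<tau>). arc_at D (lift D (snd \<tau>) s) = under_arc_from D \<tau>"
proof -
  let ?f = "snd \<tau>" and ?u = "under_time D \<tau>" and ?F = "before_side k (under_time D \<tau>)"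
  have k': "k \<in> {- 1, 1}"
    using sgn_cross [OF \<tau>] k by simp
  have "?F = at_left ?u \<or> ?F = at_right ?u"
    by (simp add: before_side_def)
  then obtain a where a: "a \<in> arcs D" "\<forall>\<^sub>F s in ?F. arc_at D (lift D ?f s) = a \<and> lift D ?f s \<in> a"
    using one_sided_arc [OF crossing_edges(2) crossing_times(2), OF \<tau> \<tau>] by blast
  define d where "d = - k *\<^sub>R direction D ?f"
  have lift: "under_point D \<tau> + s *\<^sub>R d = lift D ?f (?u - k * s)" for s
    by (simp add: crossing_points [OF \<tau>] lift_def d_def algebra_simps)
  have "\<forall>\<^sub>F s in at_right 0. lift D ?f (?u - k * s) \<in> a"
    using eventually_compose_filterlim [OF a(2) filterlim_before_side [OF k']] by eventually_elim simp
  then have in_a: "\<forall>\<^sub>F s in at_right 0. under_point D \<tau> + s *\<^sub>R d \<in> a"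
    by (simp add: lift)
  have inner: "inner (normal D (fst \<tau>)) (proj (x *\<^sub>R direction D ?f)) =
      x * cross D (fst \<tau>) ?f / cmod (vec_of D (fst \<tau>))" for x
    by (simp add: inner_normal cross_def vec_of_def linear_scale [OF proj_linear] algebra_simps)
  have d: "inner (normal D (fst \<tau>)) (proj d) < 0"
    unfolding d_def inner using crossing_transverse [OF \<tau>] vec_of_nonzero [OF crossing_edges(1) [OF \<tau>]]
    by (auto simp: k sgn_if divide_less_0_iff)
  have d_unique: "d' = d"
    if d': "d' \<in> {direction D ?f, - direction D ?f}" and inner_d': "inner (normal D (fst \<tau>)) (proj d') < 0" for d'
  proof -
    obtain x where x: "d' = x *\<^sub>R direction D ?f" "x \<in> {- 1, 1}"
    proof (cases "d' = direction D ?f")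
      case True
      then show thesis by (intro that [of 1]) simp_all
    next
      case False
      then show thesis using d' by (intro that [of "- 1"]) simp_all
    qed
    with inner_d' have "x * cross D (fst \<tau>) ?f < 0"
      unfolding x(1) inner by (simp add: divide_less_0_iff)
    with x(2) k have "x = - k"
      by (auto simp: sgn_if split: if_splits)
    with x show ?thesis
      by (simp add: d_def)
  qed
  have d_mem: "d \<in> {direction D ?f, - direction D ?f}"
    using k' by (auto simp: d_def)
  have "under_arc_from D \<tau> = a"
    unfolding under_arc_from_def
  proof (rule the_equality)
    show "a \<in> arcs D \<and> (\<exists>d\<in>{direction D ?f, - direction D ?f}. inner (normal D (fst \<tau>)) (proj d) < 0 \<and>
        (\<forall>\<^sub>F s in at_right 0. under_point D \<tau> + s *\<^sub>R d \<in> a))"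
      using a(1) d d_mem in_a by blast
  next
    fix a' assume a': "a' \<in> arcs D \<and> (\<exists>d\<in>{direction D ?f, - direction D ?f}. inner (normal D (fst \<tau>)) (proj d) < 0 \<and>
        (\<forall>\<^sub>F s in at_right 0. under_point D \<tau> + s *\<^sub>R d \<in> a'))"
    then have "\<forall>\<^sub>F s in at_right 0. under_point D \<tau> + s *\<^sub>R d \<in> a'"
      using d_unique by blast
    with in_a have "\<forall>\<^sub>F s in at_right 0. under_point D \<tau> + s *\<^sub>R d \<in> a \<inter> a'"
      by eventually_elim simp
    then have "a \<inter> a' \<noteq> {}"
      using eventually_happens' [OF trivial_limit_at_right_real] by blast
    then show "a' = a"
      using a(1) a' components_eq [of a' "cut_link D" a] by (auto simp: arcs_def)
  qed
  with a show "under_arc_from D \<tau> \<in> arcs D"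
    and "\<forall>\<^sub>F s in ?F. arc_at D (lift D ?f s) = under_arc_from D \<tau>"
    by (auto elim: eventually_mono)
qed

text \<open>The defining condition of a labelling, in a form in which the two regions are recognized by
  neighbourhoods on the two sides of the edge.\<close>

lemma label_across_edge:
  assumes \<rho>: "region_labelling D \<rho>" and e: "e \<in> edges D" and t: "t \<in> {0<..<1}"
    and u: "pt D e t \<notin> proj ` under_point D ` crossings D"
    and W: "open W" "pt D e t \<in> W"
    and r: "r1 \<in> regions D" "r2 \<in> regions D" "W \<inter> {w. side D e w < 0} \<subseteq> r1" "W \<inter> {w. 0 < side D e w} \<subseteq> r2"
  shows "\<rho> r2 = \<rho> r1 \<otimes>\<^bsub>As (fundamental_quandle D)\<^esub>
    as_gen (fundamental_quandle D) (arc_gen D (arc_at D (lift D e t)))"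
proof -
  have "source D e \<noteq> target D e"
    using vec_of_nonzero [OF e] by (auto simp: vec_of_def direction_def linear_0 [OF proj_linear])
  then have "lift D e t \<in> open_segment (source D e) (target D e)"
    by (rule open_edge_eq [OF t])
  moreover have "\<forall>\<^sub>F s in at_right 0. proj (lift D e t) - s *\<^sub>R normal D e \<in> r1 \<and>
      proj (lift D e t) + s *\<^sub>R normal D e \<in> r2"
    using push_left_right [OF e W] unfolding pt_def by eventually_elim (use r(3,4) in blast)
  ultimately show ?thesis
    using \<rho> e u r(1,2) unfolding region_labelling_def pt_def by blast
qed

text \<open>The label condition is applied at a point of the over strand close to the crossing, on the right of the
  under strand: the two sides of the over strand there lie in the two quadrants. The next lemma is the
  analogue for the under strand.\<close>

lemma label_over_side:
  assumes \<rho>: "region_labelling D \<rho>" and \<tau>: "\<tau> \<in> crossings D"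
  shows "\<rho> (quadrant D \<tau> 1 (- 1)) = \<rho> (quadrant D \<tau> (- 1) (- 1)) \<otimes>\<^bsub>As (fundamental_quandle D)\<^esub>
    as_gen (fundamental_quandle D) (arc_gen D (over_arc D \<tau>))"
proof -
  let ?W = "near D (crossing_pt D \<tau>) \<inter> {w. 0 < - 1 * side D (snd \<tau>) w}"
  define k where "k = sgn (cross D (fst \<tau>) (snd \<tau>))"
  have k: "k \<in> {- 1, 1}"
    using sgn_cross [OF \<tau>] by (simp add: k_def)
  note near = eventually_side_over [OF \<tau> k_def]
  have "\<forall>\<^sub>F s in before_side (- k) (over_time D \<tau>). pt D (fst \<tau>) s \<in> ?W"
    using k near by (auto simp: before_side_def)
  moreover have "\<forall>\<^sub>F s in before_side (- k) (over_time D \<tau>).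
      (s \<in> {0<..<1} \<and> pt D (fst \<tau>) s \<notin> proj ` under_point D ` crossings D) \<and>
      arc_at D (lift D (fst \<tau>) s) = over_arc D \<tau>"
    using eventually_not_under [OF crossing_edges(1) crossing_times(1), OF \<tau> \<tau>] arc_near_over_point(2) [OF \<tau>]
    unfolding before_side_eq by (rule eventually_conj)
  ultimately obtain s where s: "pt D (fst \<tau>) s \<in> ?W" "s \<in> {0<..<1}"
      "pt D (fst \<tau>) s \<notin> proj ` under_point D ` crossings D" "arc_at D (lift D (fst \<tau>) s) = over_arc D \<tau>"
    using eventually_happens' [OF before_side_nontrivial eventually_conj] by blast
  show ?thesis
    unfolding s(4) [symmetric]
  proof (rule label_across_edge [OF \<rho> crossing_edges(1) [OF \<tau>] s(2,3) _ s(1)])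
    show "open ?W"
      by (intro open_Int open_near open_side)
    show "?W \<inter> {w. side D (fst \<tau>) w < 0} \<subseteq> quadrant D \<tau> (- 1) (- 1)"
      using quadrant(2) [OF \<tau>, of "- 1" "- 1"] by (auto simp: sector_def)
    show "?W \<inter> {w. 0 < side D (fst \<tau>) w} \<subseteq> quadrant D \<tau> 1 (- 1)"
      using quadrant(2) [OF \<tau>, of 1 "- 1"] by (auto simp: sector_def)
  qed (use quadrant(1) [OF \<tau>] in simp_all)
qed

lemma label_under_side:
  assumes \<rho>: "region_labelling D \<rho>" and \<tau>: "\<tau> \<in> crossings D"
  shows "\<rho> (quadrant D \<tau> (- 1) 1) = \<rho> (quadrant D \<tau> (- 1) (- 1)) \<otimes>\<^bsub>As (fundamental_quandle D)\<^esub>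
    as_gen (fundamental_quandle D) (arc_gen D (under_arc_from D \<tau>))"
proof -
  let ?W = "near D (crossing_pt D \<tau>) \<inter> {w. 0 < - 1 * side D (fst \<tau>) w}"
  define k where "k = sgn (cross D (fst \<tau>) (snd \<tau>))"
  have k: "k \<in> {- 1, 1}"
    using sgn_cross [OF \<tau>] by (simp add: k_def)
  note near = eventually_side_under [OF \<tau> k_def]
  have "\<forall>\<^sub>F s in before_side k (under_time D \<tau>). pt D (snd \<tau>) s \<in> ?W"
    using k near by (auto simp: before_side_def)
  moreover have "\<forall>\<^sub>F s in before_side k (under_time D \<tau>).
      (s \<in> {0<..<1} \<and> pt D (snd \<tau>) s \<notin> proj ` under_point D ` crossings D) \<and>
      arc_at D (lift D (snd \<tau>) s) = under_arc_from D \<tau>"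
    using eventually_not_under [OF crossing_edges(2) crossing_times(2), OF \<tau> \<tau>] under_arc_from_near(2) [OF \<tau> k_def]
    unfolding before_side_eq by (rule eventually_conj)
  ultimately obtain s where s: "pt D (snd \<tau>) s \<in> ?W" "s \<in> {0<..<1}"
      "pt D (snd \<tau>) s \<notin> proj ` under_point D ` crossings D" "arc_at D (lift D (snd \<tau>) s) = under_arc_from D \<tau>"
    using eventually_happens' [OF before_side_nontrivial eventually_conj] by blast
  show ?thesis
    unfolding s(4) [symmetric]
  proof (rule label_across_edge [OF \<rho> crossing_edges(2) [OF \<tau>] s(2,3) _ s(1)])
    show "open ?W"
      by (intro open_Int open_near open_side)
    show "?W \<inter> {w. side D (snd \<tau>) w < 0} \<subseteq> quadrant D \<tau> (- 1) (- 1)"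
      using quadrant(2) [OF \<tau>, of "- 1" "- 1"] by (auto simp: sector_def)
    show "?W \<inter> {w. 0 < side D (snd \<tau>) w} \<subseteq> quadrant D \<tau> (- 1) 1"
      using quadrant(2) [OF \<tau>, of "- 1" 1] by (auto simp: sector_def)
  qed (use quadrant(1) [OF \<tau>] in simp_all)
qed

end


section \<open>The shadow and the quandle cocycle invariant\<close>

theorem theorem1p1:
  fixes L :: "(real \<Rightarrow> real^3) list"
    and D :: polylink
    and \<rho> :: "complex set \<Rightarrow> qd_elem qword set"
    and X :: "'x quandle_struct"
    and \<phi> :: "'x list \<Rightarrow> 'a::ab_group_add"
    and x :: 'x
  assumes "oriented_link L"
    and "diagram_of D L"
    and "region_labelling D \<rho>"
    and "quandle X" and "finite (carrier X)"
    and "\<phi> \<in> cocycles 2 X"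
    and "x \<in> carrier X"
  shows "shadow_cocycle_invariant D \<rho> X x (shift_pullback \<phi>) = quandle_cocycle_invariant D \<rho> X \<phi>"
proof -
  interpret quandle X by fact
  interpret regular_link_diagram D
    using assms(2) by unfold_locales (simp add: diagram_of_def)
  let ?Q = "fundamental_quandle D"
  have "pairing (iota_pullback (shift_pullback \<phi>))
        (orbit_chain_map (quandle_act X) x (induced_chain_map X c (fundamental_cycle D \<rho>))) =
      pairing (\<lambda>(_, xs). \<phi> xs)
        (orbit_chain_map trivial_act () (induced_chain_map X c (fundamental_cycle D \<rho>)))"
    if c: "c \<in> quandle_homs ?Q X" for c
  proof -
    define colour where "colour r = ext_colour X \<phi> x c (\<rho> r)" for r
    have label: "\<rho> r \<in> carrier (As ?Q)" if "r \<in> regions D" for r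
      using assms(3) that by (auto simp: region_labelling_def)
    have arc: "arc_gen D a \<in> carrier ?Q" if "a \<in> arcs D" for a
      using that by (simp add: arc_gen_def fundamental_quandle_def qgen_in_carrier)
    have step: "colour r2 = ext_step X \<phi> (colour r1) (c (arc_gen D a), True)"
      if "r1 \<in> regions D" "r2 \<in> regions D" "a \<in> arcs D"
        "\<rho> r2 = \<rho> r1 \<otimes>\<^bsub>As ?Q\<^esub> as_gen ?Q (arc_gen D a)" for r1 r2 a
      unfolding colour_def using ext_colour_mult [OF assms(6,7) c] label arc that by blast
    have term_eq: "iota_pullback (shift_pullback \<phi>)
          (quandle_act X x (as_map X c (\<rho> (specified_region D \<tau>))),
            [c (arc_gen D (under_arc_from D \<tau>)), c (arc_gen D (over_arc D \<tau>))]) =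
        \<phi> [c (arc_gen D (under_arc_from D \<tau>)), c (arc_gen D (over_arc D \<tau>))] +
        (snd (colour (quadrant D \<tau> (- 1) 1)) - snd (colour (quadrant D \<tau> 1 (- 1))))"
      if \<tau>: "\<tau> \<in> crossings D" for \<tau>
    proof -
      let ?r = "quadrant D \<tau> (- 1) (- 1)"
      obtain z \<alpha> where z: "colour ?r = (z, \<alpha>)"
        by (rule prod.exhaust)
      have r: "?r \<in> regions D" "quadrant D \<tau> (- 1) 1 \<in> regions D" "quadrant D \<tau> 1 (- 1) \<in> regions D"
        using quadrant(1) [OF \<tau>] by simp_all
      have "quandle_act X x (as_map X c (\<rho> (specified_region D \<tau>))) = z"
        using quandle_act_as_map [OF assms(6,7) c label [OF r(1)]] z
        by (simp add: specified_region_eq [OF \<tau>] colour_def)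
      moreover have "colour (quadrant D \<tau> (- 1) 1) = ext_step X \<phi> (z, \<alpha>) (c (arc_gen D (under_arc_from D \<tau>)), True)"
        using step [OF r(1,2) under_arc_from_near(1) [OF \<tau> HOL.refl] label_under_side [OF assms(3) \<tau>]] z by simp
      moreover have "colour (quadrant D \<tau> 1 (- 1)) = ext_step X \<phi> (z, \<alpha>) (c (arc_gen D (over_arc D \<tau>)), True)"
        using step [OF r(1,3) arc_near_over_point(1) [OF \<tau>] label_over_side [OF assms(3) \<tau>]] z by simp
      ultimately show ?thesis
        by (simp add: iota_pullback_2 shift_pullback_3 ext_step_def)
    qed
    show ?thesis
      by (simp add: pairing_fundamental_cycle [OF finite_crossings] term_eq int_mult_distrib sum.distrib
          sum_opposite_quadrants [of "\<lambda>r. snd (colour r)"])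
  qed
  then show ?thesis
    by (simp add: shadow_cocycle_invariant_def quandle_cocycle_invariant_def Psi_def)
qed

end
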